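(* Let $K$ be a (not necessarily finite) group, $\Gamma$ a finite set, $H\le \operatorname{Sym}(\Gamma)$, $W=K\wr_\Gamma H$ and $S=K\wr_\Gamma\operatorname{Sym}(\Gamma)$. (a) Two elements $w=(f,h)$ and $v=(e,g)$ of $S$ are conjugate in $W$ (i.e. $w^a=v$ for some $a\in W$) if and only if there exists $t\in H$ such that $h^t=g$ and $\mathcal{P}(w)^t=\mathcal{P}(v)$, where $\mathcal P$ denotes the territory decomposition. (b) Let $w=(f,h)\in S$. For each $z=(f_z,h_z)\in\mathcal{C}(w)$ choose $\gamma_z\in\operatorname{terr}(z)$. Fix a transversal $\{t_1,\dots,t_m\}$ of the right cosets of $C_H(h)$ in $H$, and for each element of the orbit $\mathcal{P}(w)^{C_H(h)}$ fix one $c\in C_H(h)$ such that this element equals $\mathcal{P}(w)^c$. Then the following map is a bijection onto the $W$-conjugacy class $w^W=\{a^{-1}wa : a\in W\}$: \[ h^H\times \mathcal{P}(w)^{C_H(h)}\times \prod_{z\in\mathcal{C}(w)}\left([\gamma_z,z]\operatorname{Yade}\right)^K\times\prod_{z\in\mathcal{C}^*(w)}K^{\operatorname{supp}(h_z)\setminus\{\gamma_z\}}\longrightarrow w^W, \] \[ (h^{t_a},\mathcal{P}(w)^c,x,d)\mapsto \prod_{z\in\mathcal{C}(w)\setminus\mathcal{C}^*(w)}\left([\gamma_z^{b_a},x_z]\mathcal{E},1_H\right)\cdot\prod_{z\in\mathcal{C}^*(w)}\left([h_z^{b_a},\gamma_z^{b_a},x_z,d_z^{b_a}]\mathcal{B},\,h_z^{b_a}\right),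 \] where $b_a:=c\cdot t_a$ with $c$ the fixed element chosen for $\mathcal{P}(w)^c$.
   Context: All groups act from the right; $x^y=y^{-1}xy$; $x^K$ is the $K$-conjugacy class of $x$; $h^H=\{t^{-1}ht: t\in H\}$ and $C_H(h)=\{t\in H: th=ht\}$ for $h\in\operatorname{Sym}(\Gamma)$. $K^\Gamma$ is the group of functions $\Gamma\to K$ under pointwise multiplication, $[\gamma]f$ is the image of $\gamma$ under $f$, and $\operatorname{Sym}(\Gamma)$ acts on $K^\Gamma$ by $[\gamma]f^h=[\gamma^{h^{-1}}]f$. $S=K\wr_\Gamma\operatorname{Sym}(\Gamma)=K^\Gamma\rtimes\operatorname{Sym}(\Gamma)$ consists of pairs $(f,h)$ with $(f,h)(e,g)=(f\cdot e^{h^{-1}},hg)$, and $W=K\wr_\Gamma H=\{(f,h)\in S: h\in H\}$. In $w=(f,h)$, $h$ is the top component. All products $\prod_{i}$ in $K$ are taken in order of increasing $i$; empty products are trivial. $\operatorname{supp}(h)$ and $\operatorname{fix}(h)$ are the sets of moved and fixed points of $h$ on $\Gamma$. The territory of $w=(f,h)\in S$ is $\operatorname{terr}(w)=\operatorname{supp}(h)\cup\{\gamma\in\Gamma:[\gamma]f\ne 1_K\}$. $w=(f,h)$ is a wreath cycle if either $h=1$ and $|\operatorname{terr}(w)|=1$, or $h$ is a single non-trivial cycle and $\operatorname{terr}(w)=\operatorname{supp}(h)$. Elements are disjoint if their territories are disjoint. Every $w=(f,h)\in S$ is a product of pairwise disjoint wreath cycles in $S$, uniquely up to order; $\mathcal{C}(w)$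 is the set of these wreath cycles. Explicitly, for $\Omega\subseteq\Gamma$ let $f|_\Omega^\Gamma$ agree with $f$ on $\Omega$ and be $1_K$ elsewhere; then $\mathcal{C}(w)$ consists of $(f|^\Gamma_{\operatorname{supp}(h_i)},h_i)$ for the non-trivial cycles $h_i$ of $h$ and $(f|^\Gamma_{\{\gamma\}},1)$ for $\gamma\in\operatorname{fix}(h)\cap\operatorname{terr}(w)$. $\mathcal{C}^*(w)$ is the set of those $z\in\mathcal{C}(w)$ with non-trivial top component. For a wreath cycle $w=(f,h)$ and $\gamma\in\Gamma$ put $[\gamma,w]\operatorname{Yade}=\prod_{i=0}^{|h|-1}[\gamma^{h^i}]f\in K$, with $|h|$ the order of $h$. The load of $w$ is $\operatorname{ld}(w)=(([\alpha,w]\operatorname{Yade})^K,|h|)$ for any $\alpha\in\operatorname{terr}(w)$ (independent of $\alpha$). For $w\in S$ let $\mathcal{L}(w)=\{\operatorname{ld}(z):z\in\mathcal{C}(w)\}$ and $\mathcal{C}(L,w)=\{z\in\mathcal{C}(w):\operatorname{ld}(z)=L\}$. The territory decomposition $\mathcal{P}(w)$ is the family, indexed by $L\in\mathcal{L}(w)$, of the sets $\{\operatorname{terr}(z):z\in\mathcal{C}(L,w)\}$. For $t\in\operatorname{Sym}(\Gamma)$, $\mathcal{P}(w)^t$ is the family with the same index set obtained by replacing each $\operatorname{terr}(z)$ by $\operatorname{terr}(z)^t$; equality of two such families includes equality of index sets. $\mathcal{P}(w)^{C_H(h)}$ is the orbit of $\mathcal{P}(w)$ under $C_H(h)$. For $\gamma'\in\Gamma$,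 $x\in K$: $[\gamma',x]\mathcal{E}\in K^\Gamma$ maps $\gamma'$ to $x$ and all other points to $1_K$. For a non-trivial cycle $h$, $\gamma_0\in\operatorname{supp}(h)$, $x\in K$ and $d\in K^{\operatorname{supp}(h)\setminus\{\gamma_0\}}$: $[h,\gamma_0,x,d]\mathcal{B}\in K^\Gamma$ maps $\gamma_0$ to $x\cdot\prod_{i=1}^{|h|-1}\left([\gamma_0^{h^{|h|-i}}]d\right)^{-1}$, maps $\gamma\in\operatorname{supp}(h)\setminus\{\gamma_0\}$ to $[\gamma]d$, and maps $\gamma\in\Gamma\setminus\operatorname{supp}(h)$ to $1_K$. For $t\in\operatorname{Sym}(\Gamma)$, $d^t\in K^{\operatorname{supp}(h^t)\setminus\{\gamma_0^t\}}$ is given by $[\delta^t]d^t=[\delta]d$. In (b), $x=(x_z)_{z\in\mathcal{C}(w)}$ and $d=(d_z)_{z\in\mathcal{C}^*(w)}$. *)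

theory Defs
  imports
    "HOL-Algebra.Multiplicative_Group"
    "HOL-Algebra.Product_Groups"
    "HOL-Combinatorics.Orbits"
begin

section \<open>Groups acting from the right\<close>

text \<open>
  Permutations act from the right: the image of \<open>\<gamma>\<close> under \<open>h\<close> is \<open>h \<gamma>\<close>, and the product
  \<open>h g\<close> means first \<open>h\<close>, then \<open>g\<close>. Hence multiplication is composition in reverse order.
\<close>

definition Sym :: "'a set \<Rightarrow> ('a \<Rightarrow> 'a) monoid" where
  "Sym \<Gamma> = \<lparr>carrier = {h. h permutes \<Gamma>}, monoid.mult = (\<lambda>h g. g \<circ> h), one = id\<rparr>"

lemma group_Sym: "group (Sym \<Gamma>)"
proof (rule groupI)
  fix h assume "h \<in> carrier (Sym \<Gamma>)"
  then have h: "h permutes \<Gamma>" by (simp add: Sym_def)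
  show "\<exists>g\<in>carrier (Sym \<Gamma>). g \<otimes>\<^bsub>Sym \<Gamma>\<^esub> h = \<one>\<^bsub>Sym \<Gamma>\<^esub>"
    by (rule bexI[of _ "inv_into UNIV h"])
      (use h in \<open>auto simp: Sym_def permutes_inv_o permutes_inv\<close>)
qed (auto simp: Sym_def comp_assoc permutes_compose permutes_id)

lemma inv_Sym: "h permutes \<Gamma> \<Longrightarrow> inv\<^bsub>Sym \<Gamma>\<^esub> h = inv_into UNIV h"
  by (rule group.inv_equality[OF group_Sym])
    (auto simp: Sym_def permutes_inv_o permutes_inv)

definition conjugate :: "('g, 'b) monoid_scheme \<Rightarrow> 'g \<Rightarrow> 'g \<Rightarrow> 'g" where
  "conjugate G x y = inv\<^bsub>G\<^esub> y \<otimes>\<^bsub>G\<^esub> x \<otimes>\<^bsub>G\<^esub> y"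

definition conj_class :: "('g, 'b) monoid_scheme \<Rightarrow> 'g set \<Rightarrow> 'g \<Rightarrow> 'g set" where
  "conj_class G A x = {conjugate G x a | a. a \<in> A}"

definition centralizer :: "('g, 'b) monoid_scheme \<Rightarrow> 'g set \<Rightarrow> 'g \<Rightarrow> 'g set" where
  "centralizer G A x = {a \<in> A. a \<otimes>\<^bsub>G\<^esub> x = x \<otimes>\<^bsub>G\<^esub> a}"

definition right_transversal :: "('g, 'b) monoid_scheme \<Rightarrow> 'g set \<Rightarrow> 'g set \<Rightarrow> bool" where
  "right_transversal G C T \<longleftrightarrow>
     T \<subseteq> carrier G \<and> (\<forall>X \<in> rcosets\<^bsub>G\<^esub> C. \<exists>!t. t \<in> T \<and> t \<in> X)"

lemma right_transversal_conjugate: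
  assumes "group G" "subgroup H G" "h \<in> carrier G"
    "right_transversal (G\<lparr>carrier := H\<rparr>) (centralizer G H h) T" "k \<in> conj_class G H h"
  shows "\<exists>!t. t \<in> T \<and> conjugate G h t = k"
proof -
  interpret group G by fact
  interpret H: subgroup H G by fact
  obtain a where a: "a \<in> H" "k = conjugate G h a"
    using assms(5) by (auto simp: conj_class_def)
  let ?X = "centralizer G H h #>\<^bsub>G\<lparr>carrier := H\<rparr>\<^esub> a"
  have T: "T \<subseteq> H" using assms(4) by (simp add: right_transversal_def)
  have X: "t \<in> ?X \<longleftrightarrow> conjugate G h t = k" if t: "t \<in> H" for t
  proof
    assume "t \<in> ?X"
    then obtain c where c: "c \<in> H" "c \<otimes>\<^bsub>G\<^esub> h = h \<otimes>\<^bsub>G\<^esub> c" "t = c \<otimes>\<^bsub>G\<^esub> a"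
      by (auto simp: r_coset_def centralizer_def)
    have "conjugate G h t =
        inv\<^bsub>G\<^esub> a \<otimes>\<^bsub>G\<^esub> (inv\<^bsub>G\<^esub> c \<otimes>\<^bsub>G\<^esub> (h \<otimes>\<^bsub>G\<^esub> c)) \<otimes>\<^bsub>G\<^esub> a"
      using c a assms(3) by (simp add: conjugate_def inv_mult_group m_assoc)
    also have "inv\<^bsub>G\<^esub> c \<otimes>\<^bsub>G\<^esub> (h \<otimes>\<^bsub>G\<^esub> c) = h"
      using c(1) assms(3) by (simp flip: c(2) add: m_assoc[symmetric])
    finally show "conjugate G h t = k" by (simp add: a conjugate_def)
  next
    assume k: "conjugate G h t = k"
    let ?c = "t \<otimes>\<^bsub>G\<^esub> inv\<^bsub>G\<^esub> a"
    have "t \<otimes>\<^bsub>G\<^esub> conjugate G h t = h \<otimes>\<^bsub>G\<^esub> t"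
      using t assms(3) by (simp add: conjugate_def m_assoc[symmetric])
    then have "h \<otimes>\<^bsub>G\<^esub> t = t \<otimes>\<^bsub>G\<^esub> (inv\<^bsub>G\<^esub> a \<otimes>\<^bsub>G\<^esub> h \<otimes>\<^bsub>G\<^esub> a)"
      using k a by (simp add: conjugate_def)
    then have "h \<otimes>\<^bsub>G\<^esub> ?c = t \<otimes>\<^bsub>G\<^esub> (inv\<^bsub>G\<^esub> a \<otimes>\<^bsub>G\<^esub> h \<otimes>\<^bsub>G\<^esub> a) \<otimes>\<^bsub>G\<^esub> inv\<^bsub>G\<^esub> a"
      using t a(1) assms(3) by (simp add: m_assoc[symmetric])
    also have "\<dots> = ?c \<otimes>\<^bsub>G\<^esub> h"
      using t a(1) assms(3) by (simp add: m_assoc)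
    finally have "?c \<in> centralizer G H h"
      using t a(1) by (simp add: centralizer_def)
    moreover have "t = ?c \<otimes>\<^bsub>G\<^esub> a" using t a(1) by (simp add: m_assoc)
    ultimately show "t \<in> ?X" unfolding r_coset_def by auto
  qed
  have "?X \<in> rcosets\<^bsub>G\<lparr>carrier := H\<rparr>\<^esub> (centralizer G H h)"
    using a(1) by (auto simp: RCOSETS_def)
  then have "\<exists>!t. t \<in> T \<and> t \<in> ?X" using assms(4) by (simp add: right_transversal_def)
  then show ?thesis using X T by (metis subsetD)
qed

definition ordered_prod :: "('g, 'b) monoid_scheme \<Rightarrow> 'g list \<Rightarrow> 'g" where
  "ordered_prod G xs = foldr (\<otimes>\<^bsub>G\<^esub>) xs \<one>\<^bsub>G\<^esub>"

text \<open>
  The product of a finite family of pairwise commuting elements of a not necessarily commutative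
  group: the common value of the products taken along all enumerations of the index set.
  The constant \<open>finprod\<close> is intended for commutative monoids only.
\<close>

definition commuting_prod :: "('g, 'b) monoid_scheme \<Rightarrow> ('i \<Rightarrow> 'g) \<Rightarrow> 'i set \<Rightarrow> 'g" where
  "commuting_prod G F A =
     (THE p. \<forall>zs. distinct zs \<and> set zs = A \<longrightarrow> ordered_prod G (map F zs) = p)"


section \<open>Wreath products\<close>

abbreviation fun_group :: "('k, 'b) monoid_scheme \<Rightarrow> 'a set \<Rightarrow> ('a \<Rightarrow> 'k) monoid" where
  "fun_group K \<Gamma> \<equiv> product_group \<Gamma> (\<lambda>_. K)"

definition fun_act :: "'a set \<Rightarrow> ('a \<Rightarrow> 'k) \<Rightarrow> ('a \<Rightarrow> 'a) \<Rightarrow> ('a \<Rightarrow> 'k)" where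
  "fun_act \<Gamma> f h = (\<lambda>\<gamma>\<in>\<Gamma>. f ((inv\<^bsub>Sym \<Gamma>\<^esub> h) \<gamma>))"

definition wreath ::
    "('k, 'b) monoid_scheme \<Rightarrow> 'a set \<Rightarrow> ('a \<Rightarrow> 'a) set \<Rightarrow> (('a \<Rightarrow> 'k) \<times> ('a \<Rightarrow> 'a)) monoid" where
  "wreath K \<Gamma> H =
     \<lparr>carrier = carrier (fun_group K \<Gamma>) \<times> H,
      monoid.mult = (\<lambda>(f, h) (e, g).
        (f \<otimes>\<^bsub>fun_group K \<Gamma>\<^esub> fun_act \<Gamma> e (inv\<^bsub>Sym \<Gamma>\<^esub> h), h \<otimes>\<^bsub>Sym \<Gamma>\<^esub> g)),
      one = (\<one>\<^bsub>fun_group K \<Gamma>\<^esub>, \<one>\<^bsub>Sym \<Gamma>\<^esub>)\<rparr>"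

abbreviation full_wreath ::
    "('k, 'b) monoid_scheme \<Rightarrow> 'a set \<Rightarrow> (('a \<Rightarrow> 'k) \<times> ('a \<Rightarrow> 'a)) monoid" where
  "full_wreath K \<Gamma> \<equiv> wreath K \<Gamma> (carrier (Sym \<Gamma>))"

lemma wreath_mult:
  assumes "h permutes \<Gamma>"
  shows "(f, h) \<otimes>\<^bsub>wreath K \<Gamma> H\<^esub> (e, g) = (\<lambda>\<gamma>\<in>\<Gamma>. f \<gamma> \<otimes>\<^bsub>K\<^esub> e (h \<gamma>), g \<circ> h)"
  using assms permutes_inv[OF assms]
  by (auto simp: wreath_def fun_act_def inv_Sym permutes_inv_inv intro!: restrict_ext)
    (simp add: Sym_def)

lemma group_full_wreath:
  fixes K (structure)
  assumes "group K"
  shows "group (full_wreath K \<Gamma>)"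
proof -
  interpret group K by fact
  have car: "(f, h) \<in> carrier (full_wreath K \<Gamma>) \<longleftrightarrow> f \<in> \<Gamma> \<rightarrow>\<^sub>E carrier K \<and> h permutes \<Gamma>" for f h
    by (simp add: wreath_def Sym_def)
  have one: "\<one>\<^bsub>full_wreath K \<Gamma>\<^esub> = (\<lambda>\<gamma>\<in>\<Gamma>. \<one>, id)"
    by (simp add: wreath_def Sym_def)
  show ?thesis
  proof (rule groupI)
    show "\<one>\<^bsub>full_wreath K \<Gamma>\<^esub> \<in> carrier (full_wreath K \<Gamma>)"
      by (auto simp: one car permutes_id)
  next
    fix x y assume "x \<in> carrier (full_wreath K \<Gamma>)" "y \<in> carrier (full_wreath K \<Gamma>)"
    then show "x \<otimes>\<^bsub>full_wreath K \<Gamma>\<^esub> y \<in> carrier (full_wreath K \<Gamma>)"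
      by (cases x; cases y)
        (auto simp: car wreath_mult permutes_compose permutes_in_image PiE_iff)
  next
    fix x y z
    assume "x \<in> carrier (full_wreath K \<Gamma>)" "y \<in> carrier (full_wreath K \<Gamma>)"
      "z \<in> carrier (full_wreath K \<Gamma>)"
    then show "x \<otimes>\<^bsub>full_wreath K \<Gamma>\<^esub> y \<otimes>\<^bsub>full_wreath K \<Gamma>\<^esub> z =
        x \<otimes>\<^bsub>full_wreath K \<Gamma>\<^esub> (y \<otimes>\<^bsub>full_wreath K \<Gamma>\<^esub> z)"
      by (cases x; cases y; cases z)
        (auto simp: car wreath_mult permutes_compose permutes_in_image PiE_iff m_assoc comp_assoc
          intro!: restrict_ext)
  next
    fix x assume "x \<in> carrier (full_wreath K \<Gamma>)"
    then show "\<one>\<^bsub>full_wreath K \<Gamma>\<^esub> \<otimes>\<^bsub>full_wreath K \<Gamma>\<^esub> x = x"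
      by (cases x)
        (auto simp: car one wreath_mult permutes_id PiE_iff extensional_def fun_eq_iff)
  next
    fix x assume x: "x \<in> carrier (full_wreath K \<Gamma>)"
    obtain f h where [simp]: "x = (f, h)" by (cases x)
    have h: "h permutes \<Gamma>" and f: "f \<in> \<Gamma> \<rightarrow>\<^sub>E carrier K" using x by (auto simp: car)
    let ?g = "inv_into UNIV h"
    have g: "?g permutes \<Gamma>" using h by (rule permutes_inv)
    have fg: "f (?g \<gamma>) \<in> carrier K" if "\<gamma> \<in> \<Gamma>" for \<gamma>
      using f that permutes_in_image[OF g, of \<gamma>] by auto
    show "\<exists>y\<in>carrier (full_wreath K \<Gamma>).
        y \<otimes>\<^bsub>full_wreath K \<Gamma>\<^esub> x = \<one>\<^bsub>full_wreath K \<Gamma>\<^esub>"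
    proof (rule bexI)
      show "(\<lambda>\<gamma>\<in>\<Gamma>. inv (f (?g \<gamma>)), ?g) \<in> carrier (full_wreath K \<Gamma>)"
        using fg by (auto simp: car g)
      show "(\<lambda>\<gamma>\<in>\<Gamma>. inv (f (?g \<gamma>)), ?g) \<otimes>\<^bsub>full_wreath K \<Gamma>\<^esub> x = \<one>\<^bsub>full_wreath K \<Gamma>\<^esub>"
        using g h fg by (auto simp: wreath_mult one permutes_inv_o intro!: restrict_ext)
    qed
  qed
qed


section \<open>Wreath cycles\<close>

definition supp :: "('a \<Rightarrow> 'a) \<Rightarrow> 'a set" where
  "supp h = {\<gamma>. h \<gamma> \<noteq> \<gamma>}"

definition terr ::
    "('k, 'b) monoid_scheme \<Rightarrow> 'a set \<Rightarrow> ('a \<Rightarrow> 'k) \<times> ('a \<Rightarrow> 'a) \<Rightarrow> 'a set" where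
  "terr K \<Gamma> w = supp (snd w) \<union> {\<gamma> \<in> \<Gamma>. fst w \<gamma> \<noteq> \<one>\<^bsub>K\<^esub>}"

definition nontrivial_cycle :: "('a \<Rightarrow> 'a) \<Rightarrow> bool" where
  "nontrivial_cycle h \<longleftrightarrow> cyclic_on h (supp h)"

definition wreath_cycle ::
    "('k, 'b) monoid_scheme \<Rightarrow> 'a set \<Rightarrow> ('a \<Rightarrow> 'k) \<times> ('a \<Rightarrow> 'a) \<Rightarrow> bool" where
  "wreath_cycle K \<Gamma> w \<longleftrightarrow> w \<in> carrier (full_wreath K \<Gamma>) \<and>
     (snd w = id \<and> card (terr K \<Gamma> w) = 1 \<or>
      nontrivial_cycle (snd w) \<and> terr K \<Gamma> w = supp (snd w))"

definition cycles_of :: "('a \<Rightarrow> 'a) \<Rightarrow> ('a \<Rightarrow> 'a) set" where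
  "cycles_of h = {perm_restrict h (orbit h \<gamma>) | \<gamma>. \<gamma> \<in> supp h}"

definition restr_one ::
    "('k, 'b) monoid_scheme \<Rightarrow> 'a set \<Rightarrow> 'a set \<Rightarrow> ('a \<Rightarrow> 'k) \<Rightarrow> ('a \<Rightarrow> 'k)" where
  "restr_one K \<Gamma> \<Omega> f = (\<lambda>\<gamma>\<in>\<Gamma>. if \<gamma> \<in> \<Omega> then f \<gamma> else \<one>\<^bsub>K\<^esub>)"

definition wreath_cycles ::
    "('k, 'b) monoid_scheme \<Rightarrow> 'a set \<Rightarrow> ('a \<Rightarrow> 'k) \<times> ('a \<Rightarrow> 'a)
      \<Rightarrow> (('a \<Rightarrow> 'k) \<times> ('a \<Rightarrow> 'a)) set" where
  "wreath_cycles K \<Gamma> w =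
     {(restr_one K \<Gamma> (supp c) (fst w), c) | c. c \<in> cycles_of (snd w)} \<union>
     {(restr_one K \<Gamma> {\<gamma>} (fst w), id) | \<gamma>. \<gamma> \<in> terr K \<Gamma> w - supp (snd w)}"

definition top_wreath_cycles ::
    "('k, 'b) monoid_scheme \<Rightarrow> 'a set \<Rightarrow> ('a \<Rightarrow> 'k) \<times> ('a \<Rightarrow> 'a)
      \<Rightarrow> (('a \<Rightarrow> 'k) \<times> ('a \<Rightarrow> 'a)) set" where
  "top_wreath_cycles K \<Gamma> w = {z \<in> wreath_cycles K \<Gamma> w. snd z \<noteq> id}"

text \<open>
  The explicit description of \<open>wreath_cycles\<close> yields a decomposition of \<open>w\<close> into pairwise
  disjoint wreath cycles.
\<close>

lemma supp_perm_restrict_orbit: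
  assumes "h permutes \<Gamma>" "finite \<Gamma>" "\<gamma> \<in> supp h"
  shows "supp (perm_restrict h (orbit h \<gamma>)) = orbit h \<gamma>"
    and "\<gamma> \<in> orbit h \<gamma>"
proof -
  show self: "\<gamma> \<in> orbit h \<gamma>"
    using assms by (meson permutation_self_in_orbit permutation_permutes)
  have "h \<delta> \<noteq> \<delta>" if "\<delta> \<in> orbit h \<gamma>" for \<delta>
  proof
    assume "h \<delta> = \<delta>"
    then have "orbit h \<delta> = {\<delta>}" by (simp add: orbit_eq_singleton_iff)
    moreover have "orbit h \<delta> = orbit h \<gamma>"
      using self that orbit_cyclic_eq3 by (metis cyclic_on_alldef cyclic_on_singleI)
    ultimately have "\<gamma> = \<delta>" using self by auto
    then show False using \<open>h \<delta> = \<delta>\<close> assms(3) by (simp add: supp_def)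
  qed
  then show "supp (perm_restrict h (orbit h \<gamma>)) = orbit h \<gamma>"
    by (auto simp: supp_def perm_restrict_def)
qed

lemma wreath_cycles_cases:
  assumes "finite \<Gamma>" "(f, h) \<in> carrier (full_wreath K \<Gamma>)" "z \<in> wreath_cycles K \<Gamma> (f, h)"
  obtains (top) \<gamma> where "\<gamma> \<in> supp h" "terr K \<Gamma> z = orbit h \<gamma>" "\<gamma> \<in> orbit h \<gamma>"
      "z = (restr_one K \<Gamma> (orbit h \<gamma>) f, perm_restrict h (orbit h \<gamma>))"
      "supp (snd z) = orbit h \<gamma>" "orbit h \<gamma> \<subseteq> supp h"
    | (base) \<gamma> where "\<gamma> \<in> \<Gamma>" "h \<gamma> = \<gamma>" "f \<gamma> \<noteq> \<one>\<^bsub>K\<^esub>" "terr K \<Gamma> z = {\<gamma>}"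
      "z = (restr_one K \<Gamma> {\<gamma>} f, id)"
proof -
  have h: "h permutes \<Gamma>" using assms(2) by (simp add: wreath_def Sym_def)
  note s = supp_perm_restrict_orbit[OF h assms(1)]
  consider \<gamma> where "\<gamma> \<in> supp h"
      "z = (restr_one K \<Gamma> (orbit h \<gamma>) f, perm_restrict h (orbit h \<gamma>))"
    | \<gamma> where "\<gamma> \<in> \<Gamma>" "h \<gamma> = \<gamma>" "f \<gamma> \<noteq> \<one>\<^bsub>K\<^esub>" "z = (restr_one K \<Gamma> {\<gamma>} f, id)"
    using assms(3) s(1)
    by (auto simp: wreath_cycles_def cycles_of_def terr_def) (auto simp: supp_def)
  then show thesis
  proof cases
    case (1 \<gamma>)
    have "terr K \<Gamma> z = orbit h \<gamma>"
      using 1 s(1)[OF 1(1)] by (auto simp: terr_def restr_one_def)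
    moreover have "orbit h \<gamma> \<subseteq> supp h"
      using s(1)[OF 1(1)] by (auto simp: supp_def perm_restrict_def split: if_splits)
    ultimately show thesis using 1 s[OF 1(1)] top by simp
  next
    case (2 \<gamma>)
    then have "terr K \<Gamma> z = {\<gamma>}" by (auto simp: terr_def restr_one_def supp_def)
    then show thesis using 2 base by simp
  qed
qed

lemma wreath_cycles_wreath_cycle:
  assumes "group K" "finite \<Gamma>" "w \<in> carrier (full_wreath K \<Gamma>)" "z \<in> wreath_cycles K \<Gamma> w"
  shows "wreath_cycle K \<Gamma> z"
proof -
  interpret group K by fact
  obtain f h where w: "w = (f, h)" by (cases w)
  have h: "h permutes \<Gamma>" and f: "f \<in> \<Gamma> \<rightarrow>\<^sub>E carrier K"
    using assms(3) by (auto simp: w wreath_def Sym_def)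
  from assms(2) assms(3)[unfolded w] assms(4)[unfolded w] show ?thesis
  proof (cases rule: wreath_cycles_cases)
    case (top \<gamma>)
    have c: "cyclic_on h (orbit h \<gamma>)" using top(3) by (rule cyclic_on_singleI) simp
    have sub: "orbit h \<gamma> \<subseteq> \<Gamma>"
      using top(6) h by (auto simp: supp_def permutes_def)
    have "bij_betw h (orbit h \<gamma>) (orbit h \<gamma>)"
      using h sub assms(2)
      by (intro bij_betw_imageI endo_inj_surj)
        (auto intro: orbit.step finite_subset permutes_inj_on)
    then have "bij_betw (perm_restrict h (orbit h \<gamma>)) (orbit h \<gamma>) (orbit h \<gamma>)"
      by (simp add: perm_restrict_def cong: bij_betw_cong)
    then have "perm_restrict h (orbit h \<gamma>) permutes orbit h \<gamma>"
      by (rule bij_imp_permutes) (simp add: perm_restrict_def)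
    then have "perm_restrict h (orbit h \<gamma>) permutes \<Gamma>"
      using sub by (rule permutes_subset)
    moreover have "restr_one K \<Gamma> (orbit h \<gamma>) f \<in> \<Gamma> \<rightarrow>\<^sub>E carrier K"
      using f by (auto simp: restr_one_def)
    ultimately have "z \<in> carrier (full_wreath K \<Gamma>)"
      using top(4) by (simp add: wreath_def Sym_def)
    moreover have "nontrivial_cycle (snd z)"
      using c top(4,5) by (simp add: nontrivial_cycle_def cyclic_on_perm_restrict)
    ultimately show ?thesis using top(2,5) by (simp add: wreath_cycle_def)
  next
    case (base \<gamma>)
    then show ?thesis using f
      by (auto simp: wreath_cycle_def wreath_def Sym_def permutes_id restr_one_def PiE_iff)
  qed
qed

lemma wreath_cycles_disjoint:
  assumes "finite \<Gamma>" "w \<in> carrier (full_wreath K \<Gamma>)"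
    "z \<in> wreath_cycles K \<Gamma> w" "z' \<in> wreath_cycles K \<Gamma> w" "z \<noteq> z'"
  shows "terr K \<Gamma> z \<inter> terr K \<Gamma> z' = {}"
proof -
  obtain f h where w: "w = (f, h)" by (cases w)
  have eq: "orbit h a = orbit h b" if "x \<in> orbit h a" "x \<in> orbit h b" "a \<in> orbit h a"
    "b \<in> orbit h b" for x a b
    using that by (metis cyclic_on_alldef cyclic_on_singleI)
  from assms(1) assms(2)[unfolded w] assms(3)[unfolded w] show ?thesis
  proof (cases rule: wreath_cycles_cases)
    case (top \<gamma>)
    note t = this
    from assms(1) assms(2)[unfolded w] assms(4)[unfolded w] show ?thesis
    proof (cases rule: wreath_cycles_cases)
      case (top \<delta>)
      then show ?thesis using t eq assms(5) by (metis disjoint_iff)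
    next
      case (base \<delta>)
      then show ?thesis using t by (auto simp: supp_def)
    qed
  next
    case (base \<gamma>)
    note b = this
    from assms(1) assms(2)[unfolded w] assms(4)[unfolded w] show ?thesis
    proof (cases rule: wreath_cycles_cases)
      case (top \<delta>)
      then show ?thesis using b by (auto simp: supp_def)
    next
      case (base \<delta>)
      then show ?thesis using b assms(5) by auto
    qed
  qed
qed

lemma commuting_prod_eqI:
  assumes "finite A"
    and "\<And>zs. distinct zs \<Longrightarrow> set zs = A \<Longrightarrow> ordered_prod G (map F zs) = p"
  shows "commuting_prod G F A = p"
  unfolding commuting_prod_def
  by (rule the_equality) (use assms finite_distinct_list[OF assms(1)] in auto)

lemma commuting_prod_wreath_cycles:
  fixes K (structure)
  assumes "group K" "finite \<Gamma>" "w \<in> carrier (full_wreath K \<Gamma>)"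
  shows "commuting_prod (full_wreath K \<Gamma>) (\<lambda>z. z) (wreath_cycles K \<Gamma> w) = w"
proof -
  interpret group K by fact
  obtain f h where w: "w = (f, h)" by (cases w)
  have h: "h permutes \<Gamma>" and f: "f \<in> \<Gamma> \<rightarrow>\<^sub>E carrier K"
    using assms(3) by (auto simp: w wreath_def Sym_def)
  have invar: "h ` terr K \<Gamma> z \<subseteq> terr K \<Gamma> z \<and>
      z = (restr_one K \<Gamma> (terr K \<Gamma> z) f, perm_restrict h (terr K \<Gamma> z))"
    if "z \<in> wreath_cycles K \<Gamma> w" for z
    using assms(2) assms(3)[unfolded w] that[unfolded w]
    by (cases rule: wreath_cycles_cases) (auto simp: perm_restrict_def intro: orbit.step)
  have perm: "snd z permutes \<Gamma>" if "z \<in> wreath_cycles K \<Gamma> w" for z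
    using wreath_cycles_wreath_cycle[OF assms that]
    by (cases z) (auto simp: wreath_cycle_def wreath_def Sym_def)
  have part: "ordered_prod (full_wreath K \<Gamma>) zs =
      (restr_one K \<Gamma> (\<Union> (terr K \<Gamma> ` set zs)) f, perm_restrict h (\<Union> (terr K \<Gamma> ` set zs)))"
    if "distinct zs" "set zs \<subseteq> wreath_cycles K \<Gamma> w" for zs
    using that
  proof (induction zs)
    case Nil
    then show ?case
      by (auto simp: ordered_prod_def wreath_def Sym_def restr_one_def perm_restrict_def)
  next
    case (Cons z zs)
    let ?D = "terr K \<Gamma> z" and ?U = "\<Union> (terr K \<Gamma> ` set zs)"
    have z: "z \<in> wreath_cycles K \<Gamma> w" using Cons.prems by simp
    have disj: "?D \<inter> ?U = {}"
      using Cons.prems wreath_cycles_disjoint[OF assms(2,3) z] by fastforce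
    have "ordered_prod (full_wreath K \<Gamma>) (z # zs) = z \<otimes>\<^bsub>full_wreath K \<Gamma>\<^esub>
        (restr_one K \<Gamma> ?U f, perm_restrict h ?U)"
      using Cons by (simp add: ordered_prod_def)
    also have "\<dots> = (restr_one K \<Gamma> ?D f, perm_restrict h ?D) \<otimes>\<^bsub>full_wreath K \<Gamma>\<^esub>
        (restr_one K \<Gamma> ?U f, perm_restrict h ?U)"
      using invar[OF z] by simp
    also have "\<dots> = (\<lambda>\<gamma>\<in>\<Gamma>. restr_one K \<Gamma> ?D f \<gamma> \<otimes> restr_one K \<Gamma> ?U f (perm_restrict h ?D \<gamma>),
        perm_restrict h ?U \<circ> perm_restrict h ?D)"
      by (rule wreath_mult) (metis invar[OF z] perm[OF z] snd_conv)
    also have "perm_restrict h ?U \<circ> perm_restrict h ?D = perm_restrict h (?U \<union> ?D)"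
      using disj invar[OF z] by (auto simp: perm_restrict_def fun_eq_iff)
    also have "(\<lambda>\<gamma>\<in>\<Gamma>. restr_one K \<Gamma> ?D f \<gamma> \<otimes> restr_one K \<Gamma> ?U f (perm_restrict h ?D \<gamma>)) =
        restr_one K \<Gamma> (?U \<union> ?D) f"
    proof -
      have "restr_one K \<Gamma> ?D f \<gamma> \<otimes> restr_one K \<Gamma> ?U f (perm_restrict h ?D \<gamma>) =
        (if \<gamma> \<in> ?U \<union> ?D then f \<gamma> else \<one>)" if "\<gamma> \<in> \<Gamma>" for \<gamma>
      proof (cases "\<gamma> \<in> ?D")
        case True
        then have "h \<gamma> \<in> ?D" using invar[OF z] by auto
        then have "h \<gamma> \<notin> ?U" using disj by blast
        then show ?thesis using True that f permutes_in_image[OF h, of \<gamma>]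
          by (auto simp: restr_one_def perm_restrict_def PiE_iff)
      next
        case False
        then show ?thesis using that f by (auto simp: restr_one_def perm_restrict_def PiE_iff)
      qed
      then show ?thesis by (auto simp: restr_one_def intro!: restrict_ext)
    qed
    finally show ?case by (simp add: Un_commute)
  qed
  have cover: "\<Union> (terr K \<Gamma> ` wreath_cycles K \<Gamma> w) = terr K \<Gamma> w"
  proof
    show "\<Union> (terr K \<Gamma> ` wreath_cycles K \<Gamma> w) \<subseteq> terr K \<Gamma> w"
    proof
      fix x assume "x \<in> \<Union> (terr K \<Gamma> ` wreath_cycles K \<Gamma> w)"
      then obtain z where z: "z \<in> wreath_cycles K \<Gamma> w" "x \<in> terr K \<Gamma> z" by blast
      from assms(2) assms(3)[unfolded w] z(1)[unfolded w] show "x \<in> terr K \<Gamma> w"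
        by (cases rule: wreath_cycles_cases) (use z(2) in \<open>auto simp: w terr_def\<close>)
    qed
    show "terr K \<Gamma> w \<subseteq> \<Union> (terr K \<Gamma> ` wreath_cycles K \<Gamma> w)"
    proof
      fix x assume x: "x \<in> terr K \<Gamma> w"
      show "x \<in> \<Union> (terr K \<Gamma> ` wreath_cycles K \<Gamma> w)"
      proof (cases "x \<in> supp h")
        case True
        note s = supp_perm_restrict_orbit[OF h assms(2) True]
        show ?thesis
          by (rule UN_I[of "(restr_one K \<Gamma> (supp (perm_restrict h (orbit h x))) f,
                perm_restrict h (orbit h x))"])
            (use s True in \<open>auto simp: w wreath_cycles_def cycles_of_def terr_def\<close>)
      next
        case False
        then show ?thesis using x
          by (intro UN_I[of "(restr_one K \<Gamma> {x} f, id)"])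
            (auto simp: w wreath_cycles_def terr_def restr_one_def)
      qed
    qed
  qed
  have "finite (wreath_cycles K \<Gamma> w)"
  proof -
    have "supp h \<subseteq> \<Gamma>" using h by (auto simp: supp_def permutes_def)
    then have "finite (supp h)" "finite (terr K \<Gamma> w)"
      using assms(2) by (auto simp: w terr_def intro: finite_subset)
    then show ?thesis by (simp add: wreath_cycles_def cycles_of_def w setcompr_eq_image)
  qed
  then show ?thesis
  proof (rule commuting_prod_eqI)
    fix zs assume "distinct zs" "set zs = wreath_cycles K \<Gamma> w"
    then have "ordered_prod (full_wreath K \<Gamma>) zs =
        (restr_one K \<Gamma> (terr K \<Gamma> w) f, perm_restrict h (terr K \<Gamma> w))"
      using part[of zs] cover by simp
    also have "restr_one K \<Gamma> (terr K \<Gamma> w) f = f"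
      using f by (auto simp: restr_one_def w terr_def PiE_iff extensional_def fun_eq_iff)
    also have "perm_restrict h (terr K \<Gamma> w) = h"
      by (auto simp: perm_restrict_def w terr_def supp_def fun_eq_iff)
    finally show "ordered_prod (full_wreath K \<Gamma>) (map (\<lambda>z. z) zs) = w"
      by (simp add: w)
  qed
qed


section \<open>Loads and the territory decomposition\<close>

definition Yade ::
    "('k, 'b) monoid_scheme \<Rightarrow> 'a set \<Rightarrow> 'a \<Rightarrow> ('a \<Rightarrow> 'k) \<times> ('a \<Rightarrow> 'a) \<Rightarrow> 'k" where
  "Yade K \<Gamma> \<gamma> w =
     ordered_prod K (map (\<lambda>i. fst w ((snd w ^^ i) \<gamma>)) [0..<group.ord (Sym \<Gamma>) (snd w)])"

definition load ::
    "('k, 'b) monoid_scheme \<Rightarrow> 'a set \<Rightarrow> ('a \<Rightarrow> 'k) \<times> ('a \<Rightarrow> 'a) \<Rightarrow> 'k set \<times> nat" where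
  "load K \<Gamma> w =
     (conj_class K (carrier K) (Yade K \<Gamma> (SOME \<alpha>. \<alpha> \<in> terr K \<Gamma> w) w),
      group.ord (Sym \<Gamma>) (snd w))"

text \<open>
  A family is encoded as a partial map whose domain is the index set, so that equality of
  families includes equality of the index sets.
\<close>

definition terr_decomp ::
    "('k, 'b) monoid_scheme \<Rightarrow> 'a set \<Rightarrow> ('a \<Rightarrow> 'k) \<times> ('a \<Rightarrow> 'a)
      \<Rightarrow> ('k set \<times> nat \<rightharpoonup> 'a set set)" where
  "terr_decomp K \<Gamma> w = (\<lambda>L.
     if L \<in> load K \<Gamma> ` wreath_cycles K \<Gamma> w
     then Some (terr K \<Gamma> ` {z \<in> wreath_cycles K \<Gamma> w. load K \<Gamma> z = L})
     else None)"

definition decomp_act :: "('l \<rightharpoonup> 'a set set) \<Rightarrow> ('a \<Rightarrow> 'a) \<Rightarrow> ('l \<rightharpoonup> 'a set set)" where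
  "decomp_act P t = (\<lambda>L. map_option (image (image t)) (P L))"


section \<open>Parametrising a conjugacy class\<close>

definition E_map :: "('k, 'b) monoid_scheme \<Rightarrow> 'a set \<Rightarrow> 'a \<Rightarrow> 'k \<Rightarrow> ('a \<Rightarrow> 'k)" where
  "E_map K \<Gamma> \<gamma>' x = (\<lambda>\<gamma>\<in>\<Gamma>. if \<gamma> = \<gamma>' then x else \<one>\<^bsub>K\<^esub>)"

definition B_map ::
    "('k, 'b) monoid_scheme \<Rightarrow> 'a set \<Rightarrow> ('a \<Rightarrow> 'a) \<Rightarrow> 'a \<Rightarrow> 'k \<Rightarrow> ('a \<Rightarrow> 'k) \<Rightarrow> ('a \<Rightarrow> 'k)" where
  "B_map K \<Gamma> h \<gamma>\<^sub>0 x d = (\<lambda>\<gamma>\<in>\<Gamma>.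
     if \<gamma> = \<gamma>\<^sub>0 then
       x \<otimes>\<^bsub>K\<^esub> ordered_prod K
         (map (\<lambda>i. inv\<^bsub>K\<^esub> (d ((h ^^ (group.ord (Sym \<Gamma>) h - i)) \<gamma>\<^sub>0)))
           [1..<group.ord (Sym \<Gamma>) h])
     else if \<gamma> \<in> supp h then d \<gamma>
     else \<one>\<^bsub>K\<^esub>)"

text \<open>For \<open>d\<close> with domain \<open>D\<close>, the function \<open>d\<^sup>t\<close> with domain \<open>t ` D\<close>.\<close>

definition shift :: "'a set \<Rightarrow> 'a set \<Rightarrow> ('a \<Rightarrow> 'k) \<Rightarrow> ('a \<Rightarrow> 'a) \<Rightarrow> ('a \<Rightarrow> 'k)" where
  "shift \<Gamma> D d t = (\<lambda>\<epsilon>\<in>t ` D. d ((inv\<^bsub>Sym \<Gamma>\<^esub> t) \<epsilon>))"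

text \<open>
  In \<open>class_param\<close> and \<open>class_map\<close>, \<open>pt\<close> chooses the points \<open>\<gamma>\<^sub>z\<close>, the set \<open>T\<close> is the
  transversal, and \<open>rep\<close> chooses for each \<open>Q\<close> in the orbit of the territory decomposition an
  element \<open>c\<close> of the centralizer. The transversal element \<open>t\<close> in \<open>class_map\<close> exists and is unique
  by \<open>right_transversal_conjugate\<close>.
\<close>

definition decomp_orbit ::
    "('k, 'b) monoid_scheme \<Rightarrow> 'a set \<Rightarrow> ('a \<Rightarrow> 'a) set \<Rightarrow> ('a \<Rightarrow> 'k) \<times> ('a \<Rightarrow> 'a)
      \<Rightarrow> ('k set \<times> nat \<rightharpoonup> 'a set set) set" where
  "decomp_orbit K \<Gamma> H w =
     {decomp_act (terr_decomp K \<Gamma> w) c | c. c \<in> centralizer (Sym \<Gamma>) H (snd w)}"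

definition class_param ::
    "('k, 'b) monoid_scheme \<Rightarrow> 'a set \<Rightarrow> ('a \<Rightarrow> 'a) set \<Rightarrow> ('a \<Rightarrow> 'k) \<times> ('a \<Rightarrow> 'a)
      \<Rightarrow> (('a \<Rightarrow> 'k) \<times> ('a \<Rightarrow> 'a) \<Rightarrow> 'a)
      \<Rightarrow> (('a \<Rightarrow> 'a) \<times> ('k set \<times> nat \<rightharpoonup> 'a set set)
          \<times> (('a \<Rightarrow> 'k) \<times> ('a \<Rightarrow> 'a) \<Rightarrow> 'k) \<times> (('a \<Rightarrow> 'k) \<times> ('a \<Rightarrow> 'a) \<Rightarrow> 'a \<Rightarrow> 'k)) set" where
  "class_param K \<Gamma> H w pt =
     conj_class (Sym \<Gamma>) H (snd w) \<times>
     decomp_orbit K \<Gamma> H w \<times>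
     (\<Pi>\<^sub>E z\<in>wreath_cycles K \<Gamma> w. conj_class K (carrier K) (Yade K \<Gamma> (pt z) z)) \<times>
     (\<Pi>\<^sub>E z\<in>top_wreath_cycles K \<Gamma> w. (supp (snd z) - {pt z}) \<rightarrow>\<^sub>E carrier K)"

definition class_map ::
    "('k, 'b) monoid_scheme \<Rightarrow> 'a set \<Rightarrow> ('a \<Rightarrow> 'k) \<times> ('a \<Rightarrow> 'a)
      \<Rightarrow> (('a \<Rightarrow> 'k) \<times> ('a \<Rightarrow> 'a) \<Rightarrow> 'a) \<Rightarrow> ('a \<Rightarrow> 'a) set
      \<Rightarrow> (('k set \<times> nat \<rightharpoonup> 'a set set) \<Rightarrow> ('a \<Rightarrow> 'a))
      \<Rightarrow> ('a \<Rightarrow> 'a) \<times> ('k set \<times> nat \<rightharpoonup> 'a set set)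
          \<times> (('a \<Rightarrow> 'k) \<times> ('a \<Rightarrow> 'a) \<Rightarrow> 'k) \<times> (('a \<Rightarrow> 'k) \<times> ('a \<Rightarrow> 'a) \<Rightarrow> 'a \<Rightarrow> 'k)
      \<Rightarrow> ('a \<Rightarrow> 'k) \<times> ('a \<Rightarrow> 'a)" where
  "class_map K \<Gamma> w pt T rep = (\<lambda>(k, Q, x, d).
     let t = (THE t. t \<in> T \<and> conjugate (Sym \<Gamma>) (snd w) t = k);
         b = rep Q \<otimes>\<^bsub>Sym \<Gamma>\<^esub> t
     in commuting_prod (full_wreath K \<Gamma>)
          (\<lambda>z. (E_map K \<Gamma> (b (pt z)) (x z), \<one>\<^bsub>Sym \<Gamma>\<^esub>))
          (wreath_cycles K \<Gamma> w - top_wreath_cycles K \<Gamma> w)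
        \<otimes>\<^bsub>full_wreath K \<Gamma>\<^esub>
        commuting_prod (full_wreath K \<Gamma>)
          (\<lambda>z. (B_map K \<Gamma> (conjugate (Sym \<Gamma>) (snd z) b) (b (pt z)) (x z)
                  (shift \<Gamma> (supp (snd z) - {pt z}) (d z) b),
                conjugate (Sym \<Gamma>) (snd z) b))
          (top_wreath_cycles K \<Gamma> w))"

end

theory Submission
  imports Defs
begin

text \<open>
  Let \<open>w = (f, h)\<close>. Going once around the orbit of \<open>h\<close> through a point \<open>\<gamma>\<close>
  and multiplying the values of \<open>f\<close> gives the orbit product of \<open>\<gamma>\<close>; its conjugacy class in \<open>K\<close>
  together with the length of the orbit is the load of the wreath cycle through \<open>\<gamma>\<close>. Class and length are
  constant on orbits, and a point outside the territory has the trivial load \<open>({1}, 1)\<close>, which no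
  point of the territory has. So the territory decomposition of \<open>w\<close> carries exactly the
  information of the function \<open>point_load f h\<close> on \<open>\<Gamma>\<close>, and for \<open>t\<close> with \<open>h\<^sup>t = g\<close> the equation
  \<open>P(w)\<^sup>t = P(v)\<close> says that \<open>t\<close> carries the loads of the points for \<open>w\<close> to those for \<open>v\<close>
  (\<open>decomp_act_eq_iff\<close>).

  Part (a). The equation \<open>w\<^sup>a = v\<close> with \<open>a = (s, t)\<close> and \<open>v = (e, g)\<close> means \<open>h\<^sup>t = g\<close> and
  \<open>f \<gamma> \<cdot> s (h \<gamma>) = s \<gamma> \<cdot> e (t \<gamma>)\<close> for all \<open>\<gamma>\<close>. Chaining these equations around an orbit shows that
  \<open>s \<gamma>\<close> conjugates the orbit product of \<open>\<gamma>\<close> into that of \<open>t \<gamma>\<close>. Conversely, on every orbit choose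
  a base point and an element conjugating one orbit product into the other as the value of \<open>s\<close>
  there; the equations then force the values of \<open>s\<close> along the orbit, and the choice at the base
  point is what makes the last equation hold when the orbit closes up
  (\<open>conjugator_of_point_load\<close>).

  Part (b). The parametrisation factors into two bijections. First fix the top component \<open>h\<close>. An
  element \<open>(e, h)\<close> in which every point has the same load as in \<open>w\<close> is determined on an orbit by its
  values away from the chosen point \<open>\<gamma>\<^sub>z\<close>, which are arbitrary, and its orbit product at \<open>\<gamma>\<^sub>z\<close>, which is
  an arbitrary element of the class of the Yade of \<open>z\<close>: the value at \<open>\<gamma>\<^sub>z\<close> can be solved for
  (\<open>bij_betw_glue\<close>). Secondly, an element \<open>v = (e, k)\<close> of the class of \<open>w\<close> determines \<open>k\<close>, hence the
  element \<open>t\<close> of the transversal, then \<open>Q\<close> from \<open>Q\<^sup>t = P(v)\<close>, hence \<open>b = c t\<close>; relabelling \<open>\<Gamma>\<close>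
  by the inverse of \<open>b\<close> turns \<open>v\<close> into an element with top component \<open>h\<close> and the same loads as
  \<open>w\<close>, and for every \<open>b\<close> all such elements arise (\<open>bij_betw_relabel\<close>). Finally, the products of the factors given by \<open>E\<close> and \<open>B\<close>
  assemble the composite of these two bijections orbit by orbit (\<open>prod_of_factors\<close>).
\<close>

section \<open>Orbits of a permutation\<close>

lemma orbit_of_permutation:
  assumes "finite \<Gamma>" "h permutes \<Gamma>"
  shows self_in_orbit: "\<gamma> \<in> orbit h \<gamma>"
    and orbit_step_eq: "orbit h (h \<gamma>) = orbit h \<gamma>"
    and orbit_eq_of_mem: "\<delta> \<in> orbit h \<gamma> \<Longrightarrow> orbit h \<delta> = orbit h \<gamma>"
proof -
  have p: "permutation h" using assms by (auto simp: permutation_permutes)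
  show "\<gamma> \<in> orbit h \<gamma>" by (rule permutation_self_in_orbit[OF p])
  show "orbit h (h \<gamma>) = orbit h \<gamma>" by (rule permutation_orbit_step[OF p])
  show "\<delta> \<in> orbit h \<gamma> \<Longrightarrow> orbit h \<delta> = orbit h \<gamma>"
    by (rule orbit_cyclic_eq3[OF cyclic_on_orbit'[OF p]])
qed

lemma orbit_enumeration:
  assumes "finite \<Gamma>" "h permutes \<Gamma>"
  shows funpow_card_orbit: "(h ^^ card (orbit h \<gamma>)) \<gamma> = \<gamma>"
    and card_orbit_pos: "0 < card (orbit h \<gamma>)"
    and inj_on_orbit_enum: "inj_on (\<lambda>i. (h ^^ i) \<gamma>) {0..<card (orbit h \<gamma>)}"
    and orbit_enum: "orbit h \<gamma> = (\<lambda>i. (h ^^ i) \<gamma>) ` {0..<card (orbit h \<gamma>)}"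
proof -
  have s: "\<gamma> \<in> orbit h \<gamma>" by (rule self_in_orbit[OF assms])
  let ?n = "funpow_dist1 h \<gamma> \<gamma>"
  note * = orbit_conv_funpow_dist1[OF s] inj_on_funpow_dist1[OF s]
  have n: "card (orbit h \<gamma>) = ?n" by (subst *(1), subst card_image[OF *(2)]) simp
  show "(h ^^ card (orbit h \<gamma>)) \<gamma> = \<gamma>" unfolding n by (rule funpow_dist1_prop[OF s])
  show "0 < card (orbit h \<gamma>)" by (simp add: n)
  show "inj_on (\<lambda>i. (h ^^ i) \<gamma>) {0..<card (orbit h \<gamma>)}" unfolding n by (rule *)
  show "orbit h \<gamma> = (\<lambda>i. (h ^^ i) \<gamma>) ` {0..<card (orbit h \<gamma>)}" unfolding n by (rule *)
qed

lemma funpow_fixes_iff_card_orbit_dvd: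
  assumes "finite \<Gamma>" "h permutes \<Gamma>"
  shows "(h ^^ n) \<gamma> = \<gamma> \<longleftrightarrow> card (orbit h \<gamma>) dvd n"
proof -
  note e = orbit_enumeration[OF assms, where \<gamma> = \<gamma>]
  let ?c = "card (orbit h \<gamma>)"
  have "(h ^^ n) \<gamma> = \<gamma> \<longleftrightarrow> (h ^^ (n mod ?c)) \<gamma> = (h ^^ 0) \<gamma>"
    using funpow_mod_eq[OF e(1)] by simp
  also have "\<dots> \<longleftrightarrow> n mod ?c = 0"
    using inj_onD[OF e(3), of "n mod ?c" 0] e(2) by auto
  finally show ?thesis by (simp add: dvd_eq_mod_eq_0)
qed

lemma perm_restrict_permutes:
  assumes "finite \<Gamma>" "h permutes \<Gamma>" "D \<subseteq> \<Gamma>" "h ` D \<subseteq> D"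
  shows "perm_restrict h D permutes \<Gamma>"
proof -
  have "bij_betw h D D"
    using assms by (intro bij_betw_imageI endo_inj_surj) (auto intro: finite_subset permutes_inj_on)
  then have "bij_betw (perm_restrict h D) D D"
    by (simp add: perm_restrict_def cong: bij_betw_cong)
  then have "perm_restrict h D permutes D"
    by (rule bij_imp_permutes) (simp add: perm_restrict_def)
  then show ?thesis using assms(3) by (rule permutes_subset)
qed

lemma perm_restrict_orbit_permutes:
  assumes "finite \<Gamma>" "h permutes \<Gamma>" "\<gamma> \<in> \<Gamma>"
  shows "perm_restrict h (orbit h \<gamma>) permutes \<Gamma>"
  by (rule perm_restrict_permutes[OF assms(1,2) permutes_orbit_subset[OF assms(2,3)]])
    (auto intro: orbit.step)

lemma funpow_perm_restrict_orbit:
  assumes "\<delta> \<in> orbit h \<gamma>"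
  shows "(perm_restrict h (orbit h \<gamma>) ^^ n) \<delta> = (h ^^ n) \<delta>"
  using assms by (induction n) (simp_all add: perm_restrict_def funpow_in_orbit)

text \<open>
  The power \<open>n\<close> of the cycle that \<open>h\<close> induces on an orbit is trivial as soon as it fixes one
  point of the orbit. This identifies the order that occurs in Yade and load with an orbit length.
\<close>

lemma ord_orbit_cycle:
  assumes "finite \<Gamma>" "h permutes \<Gamma>" "\<gamma> \<in> \<Gamma>"
  shows "group.ord (Sym \<Gamma>) (perm_restrict h (orbit h \<gamma>)) = card (orbit h \<gamma>)"
proof -
  interpret group "Sym \<Gamma>" by (rule group_Sym)
  let ?p = "perm_restrict h (orbit h \<gamma>)"
  have pow: "p [^]\<^bsub>Sym \<Gamma>\<^esub> n = p ^^ n" for p and n :: nat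
    by (induction n) (simp_all add: nat_pow_def, simp_all add: Sym_def)
  have "?p ^^ n = id \<longleftrightarrow> (h ^^ n) \<gamma> = \<gamma>" for n
  proof
    assume "?p ^^ n = id"
    then show "(h ^^ n) \<gamma> = \<gamma>"
      using funpow_perm_restrict_orbit[OF self_in_orbit[OF assms(1,2)], of n \<gamma>] by simp
  next
    assume n: "(h ^^ n) \<gamma> = \<gamma>"
    have "(?p ^^ n) \<delta> = \<delta>" for \<delta>
    proof (cases "\<delta> \<in> orbit h \<gamma>")
      case True
      then obtain i where "\<delta> = (h ^^ i) \<gamma>" using orbit_altdef[of h \<gamma>] by auto
      then have "(h ^^ n) \<delta> = (h ^^ i) ((h ^^ n) \<gamma>)"
        by (metis add.commute comp_apply funpow_add)
      then show ?thesis
        using funpow_perm_restrict_orbit[OF True] n \<open>\<delta> = (h ^^ i) \<gamma>\<close> by simp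
    next
      case False
      then show ?thesis by (induction n) (simp_all add: perm_restrict_def)
    qed
    then show "?p ^^ n = id" by auto
  qed
  then have "\<forall>n. ?p [^]\<^bsub>Sym \<Gamma>\<^esub> n = \<one>\<^bsub>Sym \<Gamma>\<^esub> \<longleftrightarrow> card (orbit h \<gamma>) dvd n"
    unfolding pow using funpow_fixes_iff_card_orbit_dvd[OF assms(1,2)]
    by (simp add: Sym_def)
  moreover have "?p \<in> carrier (Sym \<Gamma>)"
    using perm_restrict_orbit_permutes[OF assms] by (simp add: Sym_def)
  ultimately show ?thesis using ord_unique by blast
qed

lemma funpow_intertwine: "t \<circ> h = g \<circ> t \<Longrightarrow> (g ^^ n) (t \<gamma>) = t ((h ^^ n) \<gamma>)"
  by (induction n) (auto simp: fun_eq_iff)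

lemma orbit_intertwine:
  assumes "t \<circ> h = g \<circ> t"
  shows "orbit g (t \<gamma>) = t ` orbit h \<gamma>"
  using funpow_intertwine[OF assms] by (auto simp: orbit_altdef)

lemma card_orbit_intertwine:
  assumes "t \<circ> h = g \<circ> t" "t permutes \<Gamma>"
  shows "card (orbit g (t \<gamma>)) = card (orbit h \<gamma>)"
  using orbit_intertwine[OF assms(1)] card_image[OF permutes_inj_on[OF assms(2)]] by simp


section \<open>Conjugacy classes\<close>

lemma (in group) mem_conj_class_iff:
  "y \<in> conj_class G (carrier G) x \<longleftrightarrow> (\<exists>u \<in> carrier G. y = inv u \<otimes> x \<otimes> u)"
  by (auto simp: conj_class_def conjugate_def)

text \<open>
  Stating conjugacy as \<open>x u = u y\<close> rather than \<open>y = u\<^sup>-\<^sup>1 x u\<close> fits the equations that arise from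
  products along orbits, where no inverses occur.
\<close>

lemma (in group) conj_class_eqI:
  assumes "x \<in> carrier G" "y \<in> carrier G" "u \<in> carrier G" "x \<otimes> u = u \<otimes> y"
  shows "conj_class G (carrier G) x = conj_class G (carrier G) y"
proof -
  have y: "y = inv u \<otimes> x \<otimes> u"
    using assms by (metis inv_solve_left m_assoc m_closed inv_closed)
  have x: "x = u \<otimes> y \<otimes> inv u"
    using assms by (metis inv_solve_right m_closed)
  show ?thesis
  proof (intro Set.set_eqI iffI)
    fix z assume "z \<in> conj_class G (carrier G) x"
    then obtain a where a: "a \<in> carrier G" "z = inv a \<otimes> x \<otimes> a"
      by (auto simp: mem_conj_class_iff)
    then have "z = inv (inv u \<otimes> a) \<otimes> y \<otimes> (inv u \<otimes> a)"
      using assms(1-3) by (subst a(2), subst x) (simp add: inv_mult_group m_assoc)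
    then show "z \<in> conj_class G (carrier G) y"
      using a assms by (auto simp: mem_conj_class_iff)
  next
    fix z assume "z \<in> conj_class G (carrier G) y"
    then obtain a where a: "a \<in> carrier G" "z = inv a \<otimes> y \<otimes> a"
      by (auto simp: mem_conj_class_iff)
    then have "z = inv (u \<otimes> a) \<otimes> x \<otimes> (u \<otimes> a)"
      using assms(1-3) by (subst a(2), subst y) (simp add: inv_mult_group m_assoc)
    then show "z \<in> conj_class G (carrier G) x"
      using a assms by (auto simp: mem_conj_class_iff)
  qed
qed

lemma (in group) conj_class_self:
  "x \<in> carrier G \<Longrightarrow> x \<in> conj_class G (carrier G) x"
  by (auto simp: mem_conj_class_iff intro!: bexI[of _ \<one>])

lemma (in group) conj_class_eq_iff:
  assumes "x \<in> carrier G" "y \<in> carrier G"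
  shows "conj_class G (carrier G) x = conj_class G (carrier G) y \<longleftrightarrow>
    (\<exists>u \<in> carrier G. x \<otimes> u = u \<otimes> y)"
proof
  assume "conj_class G (carrier G) x = conj_class G (carrier G) y"
  then have "y \<in> conj_class G (carrier G) x" using conj_class_self assms by simp
  then obtain u where u: "u \<in> carrier G" "y = inv u \<otimes> x \<otimes> u" by (auto simp: mem_conj_class_iff)
  then have "u \<otimes> y = x \<otimes> u" using assms by (simp add: m_assoc[symmetric])
  then show "\<exists>u \<in> carrier G. x \<otimes> u = u \<otimes> y" using u by metis
qed (use conj_class_eqI assms in blast)

lemma (in group) mem_conj_class_iff_eq:
  assumes "x \<in> carrier G"
  shows "y \<in> conj_class G (carrier G) x \<longleftrightarrow>
    y \<in> carrier G \<and> conj_class G (carrier G) y = conj_class G (carrier G) x"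
proof
  assume "y \<in> conj_class G (carrier G) x"
  then obtain u where u: "u \<in> carrier G" "y = inv u \<otimes> x \<otimes> u" by (auto simp: mem_conj_class_iff)
  then have "x \<otimes> u = u \<otimes> y" "y \<in> carrier G" using assms by (simp_all add: m_assoc[symmetric])
  then show "y \<in> carrier G \<and> conj_class G (carrier G) y = conj_class G (carrier G) x"
    using conj_class_eqI assms u(1) by metis
qed (use conj_class_self in blast)

lemma (in group) conjugate_eq_iff:
  assumes "x \<in> carrier G" "a \<in> carrier G" "y \<in> carrier G"
  shows "conjugate G x a = y \<longleftrightarrow> x \<otimes> a = a \<otimes> y"
  unfolding conjugate_def using assms
  by (metis inv_closed inv_solve_left m_assoc m_closed)

lemma conjugate_Sym_eq_iff:
  assumes "h permutes \<Gamma>" "t permutes \<Gamma>" "g permutes \<Gamma>"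
  shows "conjugate (Sym \<Gamma>) h t = g \<longleftrightarrow> t \<circ> h = g \<circ> t"
  using group.conjugate_eq_iff[OF group_Sym, of h \<Gamma> t g] assms by (simp add: Sym_def)

lemma mem_full_wreath:
  "(f, h) \<in> carrier (full_wreath K \<Gamma>) \<longleftrightarrow> f \<in> \<Gamma> \<rightarrow>\<^sub>E carrier K \<and> h permutes \<Gamma>"
  by (simp add: wreath_def Sym_def)


section \<open>Products along the orbits of the top component\<close>

lemma ordered_prod_simps [simp]:
  "ordered_prod G [] = \<one>\<^bsub>G\<^esub>"
  "ordered_prod G (x # xs) = x \<otimes>\<^bsub>G\<^esub> ordered_prod G xs"
  by (simp_all add: ordered_prod_def)

lemma (in group) ordered_prod_closed:
  "set xs \<subseteq> carrier G \<Longrightarrow> ordered_prod G xs \<in> carrier G"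
  by (induction xs) auto

lemma (in group) ordered_prod_append:
  "set xs \<subseteq> carrier G \<Longrightarrow> set ys \<subseteq> carrier G \<Longrightarrow>
    ordered_prod G (xs @ ys) = ordered_prod G xs \<otimes> ordered_prod G ys"
  by (induction xs) (simp_all add: ordered_prod_closed m_assoc)

lemma (in group) ordered_prod_rev_inv:
  "set xs \<subseteq> carrier G \<Longrightarrow>
    ordered_prod G (rev (map (\<lambda>x. inv x) xs)) = inv (ordered_prod G xs)"
proof (induction xs)
  case (Cons x xs)
  then have "ordered_prod G (rev (map (\<lambda>x. inv x) xs) @ [inv x]) =
      inv (ordered_prod G xs) \<otimes> inv x"
    by (subst ordered_prod_append) auto
  then show ?case using Cons.prems by (simp add: ordered_prod_closed inv_mult_group)
qed simp

lemma map_diff_upt_eq_rev: "map (\<lambda>i. a (n - i)) [1..<n] = rev (map a [1..<n])"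
  by (rule nth_equalityI) (auto simp: rev_nth Suc_diff_Suc)

text \<open>
  Loads of wreath cycles are replaced by loads of points. On the territory, \<open>orbit_prod\<close> is the Yade
  of the wreath cycle through \<open>\<gamma>\<close> and \<open>point_load\<close> its load; but both make sense at every point of
  \<open>\<Gamma>\<close>, and they refer to \<open>f\<close> and \<open>h\<close> instead of their restrictions.
\<close>

locale wreath_base = group K for K :: "('k, 'b) monoid_scheme" (structure) +
  fixes \<Gamma> :: "'a set"
  assumes finite_base: "finite \<Gamma>"
begin

definition path_prod :: "('a \<Rightarrow> 'k) \<Rightarrow> ('a \<Rightarrow> 'a) \<Rightarrow> nat \<Rightarrow> 'a \<Rightarrow> 'k" where
  "path_prod f h n \<gamma> = ordered_prod K (map (\<lambda>i. f ((h ^^ i) \<gamma>)) [0..<n])"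

definition orbit_prod :: "('a \<Rightarrow> 'k) \<Rightarrow> ('a \<Rightarrow> 'a) \<Rightarrow> 'a \<Rightarrow> 'k" where
  "orbit_prod f h \<gamma> = path_prod f h (card (orbit h \<gamma>)) \<gamma>"

definition point_load :: "('a \<Rightarrow> 'k) \<Rightarrow> ('a \<Rightarrow> 'a) \<Rightarrow> 'a \<Rightarrow> 'k set \<times> nat" where
  "point_load f h \<gamma> = (conj_class K (carrier K) (orbit_prod f h \<gamma>), card (orbit h \<gamma>))"

lemma funpow_in_base: "h permutes \<Gamma> \<Longrightarrow> \<gamma> \<in> \<Gamma> \<Longrightarrow> (h ^^ n) \<gamma> \<in> \<Gamma>"
  by (induction n) (simp_all add: permutes_in_image)

lemma base_value_closed: "f \<in> \<Gamma> \<rightarrow>\<^sub>E carrier K \<Longrightarrow> \<gamma> \<in> \<Gamma> \<Longrightarrow> f \<gamma> \<in> carrier K"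
  by (rule PiE_mem)

context
  fixes f h
  assumes f: "f \<in> \<Gamma> \<rightarrow>\<^sub>E carrier K" and h: "h permutes \<Gamma>"
begin

lemma path_prod_closed: "\<gamma> \<in> \<Gamma> \<Longrightarrow> path_prod f h n \<gamma> \<in> carrier K"
  unfolding path_prod_def
  by (rule ordered_prod_closed) (use base_value_closed[OF f] funpow_in_base[OF h] in auto)

lemma orbit_prod_closed: "\<gamma> \<in> \<Gamma> \<Longrightarrow> orbit_prod f h \<gamma> \<in> carrier K"
  by (simp add: orbit_prod_def path_prod_closed)

lemma path_prod_Suc:
  assumes "\<gamma> \<in> \<Gamma>"
  shows "path_prod f h (Suc n) \<gamma> = path_prod f h n \<gamma> \<otimes> f ((h ^^ n) \<gamma>)"
proof -
  have "(\<lambda>i. f ((h ^^ i) \<gamma>)) ` {0..<n} \<subseteq> carrier K" "f ((h ^^ n) \<gamma>) \<in> carrier K"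
    using base_value_closed[OF f] funpow_in_base[OF h assms] by auto
  then show ?thesis by (simp add: path_prod_def ordered_prod_append)
qed

lemma path_prod_Suc_left: "path_prod f h (Suc n) \<gamma> = f \<gamma> \<otimes> path_prod f h n (h \<gamma>)"
  unfolding path_prod_def upt_conv_Cons[OF zero_less_Suc] map_Suc_upt[symmetric]
  by (simp add: comp_def funpow_swap1 del: upt_Suc)

text \<open>
  Moving the starting point one step along its orbit turns the orbit product
  \<open>k\<^sub>0 k\<^sub>1 \<dots> k\<^sub>m\<close> into \<open>k\<^sub>1 \<dots> k\<^sub>m k\<^sub>0\<close>, which is a conjugate.
\<close>

lemma point_load_step:
  assumes "\<gamma> \<in> \<Gamma>"
  shows "point_load f h (h \<gamma>) = point_load f h \<gamma>"
proof -
  let ?n = "card (orbit h \<gamma>)"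
  have n: "card (orbit h (h \<gamma>)) = ?n" using orbit_step_eq[OF finite_base h] by simp
  have "f \<gamma> \<otimes> path_prod f h ?n (h \<gamma>) = path_prod f h ?n \<gamma> \<otimes> f \<gamma>"
    using path_prod_Suc[OF assms, of ?n] path_prod_Suc_left[of ?n \<gamma>]
      funpow_card_orbit[OF finite_base h] by simp
  then have "orbit_prod f h \<gamma> \<otimes> f \<gamma> = f \<gamma> \<otimes> orbit_prod f h (h \<gamma>)"
    by (simp add: orbit_prod_def n)
  then show ?thesis unfolding point_load_def n
    using assms base_value_closed[OF f] orbit_prod_closed permutes_in_image[OF h]
    by (metis conj_class_eqI)
qed

lemma point_load_orbit:
  assumes "\<gamma> \<in> \<Gamma>" "\<delta> \<in> orbit h \<gamma>"
  shows "point_load f h \<delta> = point_load f h \<gamma>"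
  using assms(2)
proof induction
  case base
  show ?case by (rule point_load_step[OF assms(1)])
next
  case (step \<delta>)
  then show ?case using point_load_step[of \<delta>] permutes_orbit_subset[OF h assms(1)] by auto
qed

text \<open>
  A base wreath cycle has a value different from \<open>1\<close>, and a top wreath cycle has length greater
  than \<open>1\<close>. Hence the loads of the points know the territory.
\<close>

lemma point_load_trivial_iff:
  assumes "\<gamma> \<in> \<Gamma>"
  shows "point_load f h \<gamma> = ({\<one>}, 1) \<longleftrightarrow> \<gamma> \<notin> terr K \<Gamma> (f, h)"
proof -
  have one: "conj_class K (carrier K) \<one> = {\<one>}"
    using conj_class_self[of \<one>] by (auto simp: mem_conj_class_iff)
  have fixed: "card (orbit h \<gamma>) = 1 \<longleftrightarrow> h \<gamma> = \<gamma>"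
    using funpow_fixes_iff_card_orbit_dvd[OF finite_base h, of 1 \<gamma>] by simp
  show ?thesis
  proof (cases "h \<gamma> = \<gamma>")
    case True
    have "orbit_prod f h \<gamma> = f \<gamma>"
      using True fixed base_value_closed[OF f assms] by (simp add: orbit_prod_def path_prod_def)
    moreover have "conj_class K (carrier K) (f \<gamma>) = {\<one>} \<longleftrightarrow> f \<gamma> = \<one>"
      using one conj_class_self[OF base_value_closed[OF f assms]] by (metis singletonD)
    ultimately show ?thesis
      using True iffD2[OF fixed True] assms by (simp add: point_load_def terr_def supp_def)
  qed (use fixed assms in \<open>simp add: point_load_def terr_def supp_def\<close>)
qed

end


section \<open>Conjugation in the wreath product\<close>

text \<open>
  This is \<open>w a = a v\<close>, written out in components.
\<close>

lemma conjugate_wreath_eq_iff: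
  assumes "f \<in> \<Gamma> \<rightarrow>\<^sub>E carrier K" "h permutes \<Gamma>" "s \<in> \<Gamma> \<rightarrow>\<^sub>E carrier K" "t permutes \<Gamma>"
    "e \<in> \<Gamma> \<rightarrow>\<^sub>E carrier K" "g permutes \<Gamma>"
  shows "conjugate (full_wreath K \<Gamma>) (f, h) (s, t) = (e, g) \<longleftrightarrow>
    t \<circ> h = g \<circ> t \<and> (\<forall>\<gamma>\<in>\<Gamma>. f \<gamma> \<otimes> s (h \<gamma>) = s \<gamma> \<otimes> e (t \<gamma>))"
proof -
  interpret W: group "full_wreath K \<Gamma>" by (rule group_full_wreath) (rule is_group)
  have "conjugate (full_wreath K \<Gamma>) (f, h) (s, t) = (e, g) \<longleftrightarrow>
      (f, h) \<otimes>\<^bsub>full_wreath K \<Gamma>\<^esub> (s, t) = (s, t) \<otimes>\<^bsub>full_wreath K \<Gamma>\<^esub> (e, g)"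
    by (rule W.conjugate_eq_iff) (use assms in \<open>simp_all add: mem_full_wreath\<close>)
  also have "\<dots> \<longleftrightarrow> t \<circ> h = g \<circ> t \<and> (\<forall>\<gamma>\<in>\<Gamma>. f \<gamma> \<otimes> s (h \<gamma>) = s \<gamma> \<otimes> e (t \<gamma>))"
    using assms by (auto simp: wreath_mult restrict_def fun_eq_iff)
  finally show ?thesis .
qed

text \<open>
  The relations \<open>f \<gamma> \<cdot> s (h \<gamma>) = s \<gamma> \<cdot> e (t \<gamma>)\<close> telescope along an orbit.
\<close>

lemma path_prod_conjugate:
  assumes f: "f \<in> \<Gamma> \<rightarrow>\<^sub>E carrier K" and h: "h permutes \<Gamma>" and s: "s \<in> \<Gamma> \<rightarrow>\<^sub>E carrier K"
    and t: "t permutes \<Gamma>" and e: "e \<in> \<Gamma> \<rightarrow>\<^sub>E carrier K" and g: "g permutes \<Gamma>"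
    and inter: "t \<circ> h = g \<circ> t"
    and eq: "\<And>\<gamma>. \<gamma> \<in> \<Gamma> \<Longrightarrow> f \<gamma> \<otimes> s (h \<gamma>) = s \<gamma> \<otimes> e (t \<gamma>)"
    and \<gamma>: "\<gamma> \<in> \<Gamma>"
  shows "path_prod f h n \<gamma> \<otimes> s ((h ^^ n) \<gamma>) = s \<gamma> \<otimes> path_prod e g n (t \<gamma>)"
proof (induction n)
  case 0
  show ?case using base_value_closed[OF s \<gamma>] by (simp add: path_prod_def)
next
  case (Suc n)
  let ?\<delta> = "(h ^^ n) \<gamma>"
  have t\<gamma>: "t \<gamma> \<in> \<Gamma>" using \<gamma> permutes_in_image[OF t] by simp
  have \<delta>: "?\<delta> \<in> \<Gamma>" "h ?\<delta> \<in> \<Gamma>" "t ?\<delta> \<in> \<Gamma>"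
    using funpow_in_base[OF h \<gamma>] permutes_in_image[OF h] permutes_in_image[OF t] by auto
  note c = base_value_closed[OF f] base_value_closed[OF s] base_value_closed[OF e]
    path_prod_closed[OF f h] path_prod_closed[OF e g]
  have "path_prod f h (Suc n) \<gamma> \<otimes> s ((h ^^ Suc n) \<gamma>) =
      path_prod f h n \<gamma> \<otimes> (f ?\<delta> \<otimes> s (h ?\<delta>))"
    using \<gamma> \<delta> c by (simp add: path_prod_Suc[OF f h] m_assoc)
  also have "\<dots> = (path_prod f h n \<gamma> \<otimes> s ?\<delta>) \<otimes> e (t ?\<delta>)"
    using \<gamma> \<delta> c by (simp add: eq m_assoc)
  also have "\<dots> = s \<gamma> \<otimes> path_prod e g (Suc n) (t \<gamma>)"
    unfolding Suc using \<gamma> t\<gamma> \<delta> c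
    by (simp add: path_prod_Suc[OF e g] m_assoc funpow_intertwine[OF inter])
  finally show ?case .
qed

lemma point_load_conjugate:
  assumes f: "f \<in> \<Gamma> \<rightarrow>\<^sub>E carrier K" and h: "h permutes \<Gamma>" and s: "s \<in> \<Gamma> \<rightarrow>\<^sub>E carrier K"
    and t: "t permutes \<Gamma>" and e: "e \<in> \<Gamma> \<rightarrow>\<^sub>E carrier K" and g: "g permutes \<Gamma>"
    and inter: "t \<circ> h = g \<circ> t"
    and eq: "\<And>\<gamma>. \<gamma> \<in> \<Gamma> \<Longrightarrow> f \<gamma> \<otimes> s (h \<gamma>) = s \<gamma> \<otimes> e (t \<gamma>)"
    and \<gamma>: "\<gamma> \<in> \<Gamma>"
  shows "point_load f h \<gamma> = point_load e g (t \<gamma>)"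
proof -
  have "orbit_prod f h \<gamma> \<otimes> s \<gamma> = s \<gamma> \<otimes> orbit_prod e g (t \<gamma>)"
    using path_prod_conjugate[OF assms, of "card (orbit h \<gamma>)"]
      funpow_card_orbit[OF finite_base h] card_orbit_intertwine[OF inter t]
    by (simp add: orbit_prod_def)
  then have "conj_class K (carrier K) (orbit_prod f h \<gamma>) =
      conj_class K (carrier K) (orbit_prod e g (t \<gamma>))"
    using \<gamma> permutes_in_image[OF t]
    by (intro conj_class_eqI[of _ _ "s \<gamma>"] orbit_prod_closed[OF f h] orbit_prod_closed[OF e g]
        base_value_closed[OF s]) auto
  then show ?thesis using card_orbit_intertwine[OF inter t] by (simp add: point_load_def)
qed

text \<open>
  Let \<open>r\<close> be the base point of the orbit of \<open>\<gamma> = h\<^sup>i r\<close> and let \<open>u\<close> conjugate the orbit product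
  of \<open>r\<close> into that of \<open>t r\<close>. Solving the telescoped relation \<open>path_prod_conjugate\<close> with
  \<open>s r = u\<close> leaves only one candidate for \<open>s \<gamma>\<close>. The relation between consecutive points of the
  orbit then holds by construction, except at the last point, where it says that \<open>u\<close> has the
  conjugating property by which it was chosen.
\<close>

lemma conjugator_of_point_load:
  assumes f: "f \<in> \<Gamma> \<rightarrow>\<^sub>E carrier K" and h: "h permutes \<Gamma>"
    and t: "t permutes \<Gamma>" and e: "e \<in> \<Gamma> \<rightarrow>\<^sub>E carrier K" and g: "g permutes \<Gamma>"
    and inter: "t \<circ> h = g \<circ> t"
    and load: "\<And>\<gamma>. \<gamma> \<in> \<Gamma> \<Longrightarrow> point_load f h \<gamma> = point_load e g (t \<gamma>)"
  obtains s where "s \<in> \<Gamma> \<rightarrow>\<^sub>E carrier K"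
    "\<And>\<gamma>. \<gamma> \<in> \<Gamma> \<Longrightarrow> f \<gamma> \<otimes> s (h \<gamma>) = s \<gamma> \<otimes> e (t \<gamma>)"
proof -
  note orb = self_in_orbit[OF finite_base h] orbit_eq_of_mem[OF finite_base h]
  let ?P = "path_prod f h" and ?Q = "path_prod e g"
  define r where "r \<gamma> = (SOME \<delta>. \<delta> \<in> orbit h \<gamma>)" for \<gamma>
  have r: "r \<gamma> \<in> orbit h \<gamma>" for \<gamma> unfolding r_def by (rule someI[of _ \<gamma>]) (rule orb)
  have r\<Gamma>: "r \<gamma> \<in> \<Gamma>" if "\<gamma> \<in> \<Gamma>" for \<gamma> using permutes_orbit_subset[OF h that] r by auto
  have r_step: "r (h \<gamma>) = r \<gamma>" for \<gamma>
    unfolding r_def orbit_step_eq[OF finite_base h] ..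
  define c where "c \<gamma> = card (orbit h \<gamma>)" for \<gamma>
  have c_r: "card (orbit h (r \<gamma>)) = c \<gamma>" for \<gamma> unfolding c_def orb(2)[OF r] ..
  define u where "u \<delta> = (SOME u. u \<in> carrier K \<and>
      orbit_prod f h \<delta> \<otimes> u = u \<otimes> orbit_prod e g (t \<delta>))" for \<delta>
  have u: "u \<delta> \<in> carrier K \<and> orbit_prod f h \<delta> \<otimes> u \<delta> = u \<delta> \<otimes> orbit_prod e g (t \<delta>)"
    if "\<delta> \<in> \<Gamma>" for \<delta>
  proof -
    have "\<exists>u. u \<in> carrier K \<and> orbit_prod f h \<delta> \<otimes> u = u \<otimes> orbit_prod e g (t \<delta>)"
      using load[OF that] conj_class_eq_iff[OF orbit_prod_closed[OF f h that]
          orbit_prod_closed[OF e g]] that permutes_in_image[OF t]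
      by (auto simp: point_load_def)
    then show ?thesis unfolding u_def by (rule someI_ex)
  qed
  define i where "i \<gamma> = (SOME i. i < c \<gamma> \<and> (h ^^ i) (r \<gamma>) = \<gamma>)" for \<gamma>
  have i: "i \<gamma> < c \<gamma>" "(h ^^ i \<gamma>) (r \<gamma>) = \<gamma>" for \<gamma>
  proof -
    have "\<gamma> \<in> orbit h (r \<gamma>)" using orb(1) orb(2)[OF r] by auto
    then have "\<exists>i. i < c \<gamma> \<and> (h ^^ i) (r \<gamma>) = \<gamma>"
      using orbit_enum[OF finite_base h, of "r \<gamma>"] unfolding c_r by auto
    then have "i \<gamma> < c \<gamma> \<and> (h ^^ i \<gamma>) (r \<gamma>) = \<gamma>" unfolding i_def by (rule someI_ex)
    then show "i \<gamma> < c \<gamma>" "(h ^^ i \<gamma>) (r \<gamma>) = \<gamma>" by auto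
  qed
  define s where "s = (\<lambda>\<gamma>\<in>\<Gamma>. inv (?P (i \<gamma>) (r \<gamma>)) \<otimes> u (r \<gamma>) \<otimes> ?Q (i \<gamma>) (t (r \<gamma>)))"
  show thesis
  proof (rule that[of s])
    show "s \<in> \<Gamma> \<rightarrow>\<^sub>E carrier K"
      unfolding s_def
      using r\<Gamma> u path_prod_closed[OF f h] path_prod_closed[OF e g] permutes_in_image[OF t] by auto
  next
    fix \<gamma> assume \<gamma>: "\<gamma> \<in> \<Gamma>"
    let ?r = "r \<gamma>" and ?i = "i \<gamma>"
    have h\<gamma>: "h \<gamma> \<in> \<Gamma>" using \<gamma> permutes_in_image[OF h] by simp
    have r0: "?r \<in> \<Gamma>" "t ?r \<in> \<Gamma>" "t \<gamma> \<in> \<Gamma>" using r\<Gamma> \<gamma> permutes_in_image[OF t] by auto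
    have cl: "?P n ?r \<in> carrier K" "?Q n (t ?r) \<in> carrier K" "u ?r \<in> carrier K"
      "f \<gamma> \<in> carrier K" "e (t \<gamma>) \<in> carrier K" for n
      using r0 \<gamma> path_prod_closed[OF f h] path_prod_closed[OF e g] u base_value_closed[OF f]
        base_value_closed[OF e] by auto
    have P: "?P (Suc ?i) ?r = ?P ?i ?r \<otimes> f \<gamma>"
      using path_prod_Suc[OF f h r0(1), of ?i] i by simp
    have Q: "?Q (Suc ?i) (t ?r) = ?Q ?i (t ?r) \<otimes> e (t \<gamma>)"
      using path_prod_Suc[OF e g r0(2), of ?i] i funpow_intertwine[OF inter] by simp
    have step: "s (h \<gamma>) = inv (?P (Suc ?i) ?r) \<otimes> u ?r \<otimes> ?Q (Suc ?i) (t ?r)"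
    proof (cases "Suc ?i < c \<gamma>")
      case True
      have "(h ^^ i (h \<gamma>)) ?r = (h ^^ Suc ?i) ?r"
        using i(2)[of "h \<gamma>"] i(2)[of \<gamma>] r_step by simp
      moreover have "i (h \<gamma>) < c \<gamma>"
        using i(1)[of "h \<gamma>"] by (simp add: c_def orbit_step_eq[OF finite_base h])
      ultimately have "i (h \<gamma>) = Suc ?i"
        using inj_onD[OF inj_on_orbit_enum[OF finite_base h, of ?r]] True unfolding c_r by simp
      then show ?thesis using h\<gamma> r_step by (simp add: s_def)
    next
      \<comment> \<open>The orbit closes up: both products are orbit products, and \<open>u\<close> conjugates one into the
        other.\<close>
      case False
      then have n: "Suc ?i = c \<gamma>" using i(1)[of \<gamma>] by simp
      have "h \<gamma> = ?r"
        using funpow_card_orbit[OF finite_base h, of ?r] i(2)[of \<gamma>]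
        unfolding c_r n[symmetric] by simp
      then have "(h ^^ i (h \<gamma>)) ?r = (h ^^ 0) ?r"
        using i(2)[of "h \<gamma>"] r_step[of \<gamma>] by (metis funpow_0)
      moreover have "i (h \<gamma>) < c \<gamma>" "0 < c \<gamma>"
        using i(1)[of "h \<gamma>"] n by (auto simp: c_def orbit_step_eq[OF finite_base h])
      ultimately have "i (h \<gamma>) = 0"
        using inj_onD[OF inj_on_orbit_enum[OF finite_base h, of ?r]] unfolding c_r by simp
      then have "s (h \<gamma>) = u ?r"
        using h\<gamma> r_step cl by (simp add: s_def path_prod_def)
      moreover have "?P (Suc ?i) ?r \<otimes> u ?r = u ?r \<otimes> ?Q (Suc ?i) (t ?r)"
        using u[OF r0(1)] unfolding orbit_prod_def card_orbit_intertwine[OF inter t] c_r n by simp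
      ultimately show ?thesis using cl by (metis inv_closed inv_solve_left m_assoc m_closed)
    qed
    have "f \<gamma> \<otimes> s (h \<gamma>) = inv (?P ?i ?r) \<otimes> u ?r \<otimes> (?Q ?i (t ?r) \<otimes> e (t \<gamma>))"
      unfolding step P Q using cl by (simp add: inv_mult_group m_assoc[symmetric])
    then show "f \<gamma> \<otimes> s (h \<gamma>) = s \<gamma> \<otimes> e (t \<gamma>)"
      using \<gamma> cl by (simp add: s_def m_assoc)
  qed
qed

section \<open>The territory decomposition in terms of loads of points\<close>

text \<open>
  The wreath cycle of \<open>(f, h)\<close> through a point of the territory. A fixed point \<open>\<gamma>\<close> of \<open>h\<close> has orbit
  \<open>{\<gamma>}\<close>, on which \<open>h\<close> restricts to the identity, so both kinds of wreath cycles are covered.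
\<close>

definition orbit_cycle ::
    "('a \<Rightarrow> 'k) \<Rightarrow> ('a \<Rightarrow> 'a) \<Rightarrow> 'a \<Rightarrow> ('a \<Rightarrow> 'k) \<times> ('a \<Rightarrow> 'a)" where
  "orbit_cycle f h \<gamma> = (restr_one K \<Gamma> (orbit h \<gamma>) f, perm_restrict h (orbit h \<gamma>))"

context
  fixes f h
  assumes f: "f \<in> \<Gamma> \<rightarrow>\<^sub>E carrier K" and h: "h permutes \<Gamma>"
begin

lemma terr_subset_base: "terr K \<Gamma> (f, h) \<subseteq> \<Gamma>"
  using h by (auto simp: terr_def supp_def permutes_def)

lemma terr_orbit_closed:
  assumes "\<gamma> \<in> terr K \<Gamma> (f, h)" "\<delta> \<in> orbit h \<gamma>"
  shows "\<delta> \<in> terr K \<Gamma> (f, h)"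
proof -
  have "\<gamma> \<in> \<Gamma>" using assms(1) terr_subset_base by blast
  then have "\<delta> \<in> \<Gamma>" using assms(2) permutes_orbit_subset[OF h] by blast
  then show ?thesis
    using point_load_orbit[OF f h \<open>\<gamma> \<in> \<Gamma>\<close> assms(2)] point_load_trivial_iff[OF f h] \<open>\<gamma> \<in> \<Gamma>\<close> assms(1)
    by metis
qed

lemma orbit_cycle_fixed:
  assumes "h \<gamma> = \<gamma>"
  shows "orbit_cycle f h \<gamma> = (restr_one K \<Gamma> {\<gamma>} f, id)" "orbit h \<gamma> = {\<gamma>}"
proof -
  show *: "orbit h \<gamma> = {\<gamma>}" using assms by (simp add: orbit_eq_singleton_iff)
  show "orbit_cycle f h \<gamma> = (restr_one K \<Gamma> {\<gamma>} f, id)"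
    using assms by (auto simp: orbit_cycle_def * perm_restrict_def)
qed

lemma wreath_cycles_eq_orbit_cycles:
  "wreath_cycles K \<Gamma> (f, h) = orbit_cycle f h ` terr K \<Gamma> (f, h)"
proof (intro Set.set_eqI iffI)
  fix z assume z: "z \<in> wreath_cycles K \<Gamma> (f, h)"
  have "(f, h) \<in> carrier (full_wreath K \<Gamma>)" using f h by (simp add: mem_full_wreath)
  from finite_base this z show "z \<in> orbit_cycle f h ` terr K \<Gamma> (f, h)"
  proof (cases rule: wreath_cycles_cases)
    case (top \<gamma>)
    show ?thesis
    proof (rule image_eqI)
      show "z = orbit_cycle f h \<gamma>" using top(4) by (simp only: orbit_cycle_def)
      show "\<gamma> \<in> terr K \<Gamma> (f, h)" using top(1) by (simp add: terr_def)
    qed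
  next
    case (base \<gamma>)
    show ?thesis
    proof (rule image_eqI)
      show "z = orbit_cycle f h \<gamma>" using base(2,5) by (simp only: orbit_cycle_fixed)
      show "\<gamma> \<in> terr K \<Gamma> (f, h)" using base(1,3) by (simp add: terr_def)
    qed
  qed
next
  fix z assume "z \<in> orbit_cycle f h ` terr K \<Gamma> (f, h)"
  then obtain \<gamma> where \<gamma>: "\<gamma> \<in> terr K \<Gamma> (f, h)" "z = orbit_cycle f h \<gamma>" by auto
  show "z \<in> wreath_cycles K \<Gamma> (f, h)"
  proof (cases "\<gamma> \<in> supp h")
    case True
    then have "perm_restrict h (orbit h \<gamma>) \<in> cycles_of h" by (auto simp: cycles_of_def)
    moreover have "z = (restr_one K \<Gamma> (supp (perm_restrict h (orbit h \<gamma>))) f,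
        perm_restrict h (orbit h \<gamma>))"
      unfolding supp_perm_restrict_orbit(1)[OF h finite_base True] \<gamma>(2) orbit_cycle_def ..
    ultimately show ?thesis unfolding wreath_cycles_def fst_conv snd_conv by blast
  next
    case False
    then have "h \<gamma> = \<gamma>" by (simp add: supp_def)
    then have "z = (restr_one K \<Gamma> {\<gamma>} f, id)" using \<gamma>(2) by (simp only: orbit_cycle_fixed)
    then show ?thesis
      using \<gamma>(1) False unfolding wreath_cycles_def fst_conv snd_conv by blast
  qed
qed

lemma finite_wreath_cycles: "finite (wreath_cycles K \<Gamma> (f, h))"
  unfolding wreath_cycles_eq_orbit_cycles
  by (rule finite_imageI, rule finite_subset[OF terr_subset_base finite_base])

lemma supp_orbit_cycle:
  "supp (snd (orbit_cycle f h \<gamma>)) = (if h \<gamma> = \<gamma> then {} else orbit h \<gamma>)"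
  using supp_perm_restrict_orbit(1)[OF h finite_base, of \<gamma>] orbit_cycle_fixed(1)
  by (auto simp: orbit_cycle_def supp_def)

lemma terr_orbit_cycle:
  assumes "\<gamma> \<in> terr K \<Gamma> (f, h)"
  shows "terr K \<Gamma> (orbit_cycle f h \<gamma>) = orbit h \<gamma>"
proof (cases "h \<gamma> = \<gamma>")
  case True
  then have "\<gamma> \<in> \<Gamma>" "f \<gamma> \<noteq> \<one>" using assms by (auto simp: terr_def supp_def)
  then show ?thesis using True by (auto simp: terr_def orbit_cycle_fixed supp_def restr_one_def)
next
  case False
  then have "supp (snd (orbit_cycle f h \<gamma>)) = orbit h \<gamma>" by (simp add: supp_orbit_cycle)
  then show ?thesis by (auto simp: terr_def orbit_cycle_def restr_one_def)
qed

lemma orbit_cycle_eq: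
  assumes "\<delta> \<in> orbit h \<gamma>"
  shows "orbit_cycle f h \<delta> = orbit_cycle f h \<gamma>"
  using orbit_eq_of_mem[OF finite_base h assms] by (simp add: orbit_cycle_def)

lemma Yade_orbit_cycle:
  assumes "\<gamma> \<in> \<Gamma>" "\<delta> \<in> orbit h \<gamma>"
  shows "Yade K \<Gamma> \<delta> (orbit_cycle f h \<gamma>) = orbit_prod f h \<delta>"
proof -
  have n: "card (orbit h \<delta>) = group.ord (Sym \<Gamma>) (snd (orbit_cycle f h \<gamma>))"
    using ord_orbit_cycle[OF finite_base h assms(1)] orbit_eq_of_mem[OF finite_base h assms(2)]
    by (simp add: orbit_cycle_def)
  have "(h ^^ i) \<delta> \<in> orbit h \<gamma> \<inter> \<Gamma>" for i
    using funpow_in_orbit[OF assms(2)] permutes_orbit_subset[OF h assms(1)] by auto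
  then show ?thesis unfolding Yade_def orbit_prod_def path_prod_def n
    by (intro arg_cong[where f = "ordered_prod K"] map_cong refl)
      (simp add: orbit_cycle_def funpow_perm_restrict_orbit[OF assms(2)] restr_one_def)
qed

lemma load_orbit_cycle:
  assumes "\<gamma> \<in> terr K \<Gamma> (f, h)"
  shows "load K \<Gamma> (orbit_cycle f h \<gamma>) = point_load f h \<gamma>"
proof -
  have \<gamma>: "\<gamma> \<in> \<Gamma>" using assms terr_subset_base by blast
  let ?\<alpha> = "SOME \<alpha>. \<alpha> \<in> terr K \<Gamma> (orbit_cycle f h \<gamma>)"
  have \<alpha>: "?\<alpha> \<in> orbit h \<gamma>"
    unfolding terr_orbit_cycle[OF assms]
    by (rule someI[of _ \<gamma>]) (rule self_in_orbit[OF finite_base h])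
  have "load K \<Gamma> (orbit_cycle f h \<gamma>) = point_load f h ?\<alpha>"
    using Yade_orbit_cycle[OF \<gamma> \<alpha>] ord_orbit_cycle[OF finite_base h \<gamma>]
      orbit_eq_of_mem[OF finite_base h \<alpha>]
    by (simp add: load_def point_load_def) (simp add: orbit_cycle_def)
  then show ?thesis using point_load_orbit[OF f h \<gamma> \<alpha>] by simp
qed

text \<open>
  With this description of the territory decomposition the wreath cycles drop out of the argument:
  only orbits and loads of points remain.
\<close>

lemma terr_decomp_eq:
  "terr_decomp K \<Gamma> (f, h) = (\<lambda>L.
     if L \<in> point_load f h ` terr K \<Gamma> (f, h)
     then Some (orbit h ` {\<gamma> \<in> terr K \<Gamma> (f, h). point_load f h \<gamma> = L}) else None)"
proof -
  let ?R = "terr K \<Gamma> (f, h)"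
  have 1: "load K \<Gamma> ` wreath_cycles K \<Gamma> (f, h) = point_load f h ` ?R"
    unfolding wreath_cycles_eq_orbit_cycles image_image
    by (rule image_cong) (simp_all add: load_orbit_cycle)
  have 2: "terr K \<Gamma> ` {z \<in> wreath_cycles K \<Gamma> (f, h). load K \<Gamma> z = L} =
      orbit h ` {\<gamma> \<in> ?R. point_load f h \<gamma> = L}" for L
  proof -
    have "{z \<in> wreath_cycles K \<Gamma> (f, h). load K \<Gamma> z = L} =
        orbit_cycle f h ` {\<gamma> \<in> ?R. load K \<Gamma> (orbit_cycle f h \<gamma>) = L}"
      unfolding wreath_cycles_eq_orbit_cycles by blast
    also have "{\<gamma> \<in> ?R. load K \<Gamma> (orbit_cycle f h \<gamma>) = L} = {\<gamma> \<in> ?R. point_load f h \<gamma> = L}"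
      by (rule Collect_cong, rule conj_cong) (simp_all add: load_orbit_cycle)
    finally have "terr K \<Gamma> ` {z \<in> wreath_cycles K \<Gamma> (f, h). load K \<Gamma> z = L} =
        (\<lambda>\<gamma>. terr K \<Gamma> (orbit_cycle f h \<gamma>)) ` {\<gamma> \<in> ?R. point_load f h \<gamma> = L}"
      by (simp only: image_image)
    also have "\<dots> = orbit h ` {\<gamma> \<in> ?R. point_load f h \<gamma> = L}"
      by (rule image_cong) (simp_all add: terr_orbit_cycle)
    finally show ?thesis .
  qed
  show ?thesis unfolding terr_decomp_def 1 2 ..
qed

end

text \<open>
  The sets indexed by \<open>L\<close> consist of the orbits of the points of load \<open>L\<close>, and \<open>t\<close> maps orbits of \<open>h\<close>
  to orbits of \<open>g\<close>. For the direction from left to right, a point outside one territory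
  corresponds to a point outside the other, because territories are unions of orbits, and such
  points have the trivial load.
\<close>

lemma decomp_act_eq_iff:
  assumes f: "f \<in> \<Gamma> \<rightarrow>\<^sub>E carrier K" and h: "h permutes \<Gamma>"
    and e: "e \<in> \<Gamma> \<rightarrow>\<^sub>E carrier K" and g: "g permutes \<Gamma>"
    and t: "t permutes \<Gamma>" and inter: "t \<circ> h = g \<circ> t"
  shows "decomp_act (terr_decomp K \<Gamma> (f, h)) t = terr_decomp K \<Gamma> (e, g) \<longleftrightarrow>
    (\<forall>\<gamma>\<in>\<Gamma>. point_load f h \<gamma> = point_load e g (t \<gamma>))"
    (is "?L \<longleftrightarrow> ?R")
proof
  assume ?R
  let ?X = "terr K \<Gamma> (f, h)" and ?Y = "terr K \<Gamma> (e, g)"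
  have mem: "\<gamma> \<in> ?X \<longleftrightarrow> t \<gamma> \<in> ?Y" if "\<gamma> \<in> \<Gamma>" for \<gamma>
    using \<open>?R\<close> that point_load_trivial_iff[OF f h that]
      point_load_trivial_iff[OF e g, of "t \<gamma>"] permutes_in_image[OF t, of \<gamma>] by auto
  have Y: "?Y = t ` ?X"
  proof (intro Set.set_eqI iffI)
    fix \<delta> assume \<delta>: "\<delta> \<in> ?Y"
    then have "\<delta> \<in> t ` \<Gamma>" using terr_subset_base[OF e g] permutes_image[OF t] by blast
    then show "\<delta> \<in> t ` ?X" using mem \<delta> by auto
  qed (use mem terr_subset_base[OF f h] in blast)
  have load: "point_load e g (t \<gamma>) = point_load f h \<gamma>" if "\<gamma> \<in> ?X" for \<gamma>
    using \<open>?R\<close> that terr_subset_base[OF f h] by auto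
  have 1: "point_load e g ` ?Y = point_load f h ` ?X"
    unfolding Y image_image by (rule image_cong) (simp_all add: load)
  have 2: "orbit g ` {\<delta> \<in> ?Y. point_load e g \<delta> = L} =
      image t ` orbit h ` {\<gamma> \<in> ?X. point_load f h \<gamma> = L}" for L
  proof -
    have "{\<delta> \<in> ?Y. point_load e g \<delta> = L} = t ` {\<gamma> \<in> ?X. point_load e g (t \<gamma>) = L}"
      unfolding Y by blast
    also have "{\<gamma> \<in> ?X. point_load e g (t \<gamma>) = L} = {\<gamma> \<in> ?X. point_load f h \<gamma> = L}"
      by (rule Collect_cong, rule conj_cong) (simp_all add: load)
    finally show ?thesis by (simp only: image_image orbit_intertwine[OF inter])
  qed
  show ?L
    unfolding terr_decomp_eq[OF f h] terr_decomp_eq[OF e g] decomp_act_def 1 2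
    by (rule ext) simp
next
  assume ?L
  let ?X = "terr K \<Gamma> (f, h)" and ?Y = "terr K \<Gamma> (e, g)"
  have img: "image t ` orbit h ` {\<gamma> \<in> ?X. point_load f h \<gamma> = L} =
        orbit g ` {\<delta> \<in> ?Y. point_load e g \<delta> = L}"
    if "L \<in> point_load f h ` ?X \<or> L \<in> point_load e g ` ?Y" for L
    using fun_cong[OF \<open>?L\<close>, of L] that
    unfolding terr_decomp_eq[OF f h] terr_decomp_eq[OF e g] decomp_act_def
    by (simp split: if_splits)
  have fwd: "point_load f h \<gamma> = point_load e g (t \<gamma>) \<and> t \<gamma> \<in> ?Y" if \<gamma>: "\<gamma> \<in> ?X" for \<gamma>
  proof -
    have "t ` orbit h \<gamma> \<in> image t ` orbit h ` {\<gamma>' \<in> ?X. point_load f h \<gamma>' = point_load f h \<gamma>}"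
      using \<gamma> by blast
    then have "t ` orbit h \<gamma> \<in> orbit g ` {\<delta> \<in> ?Y. point_load e g \<delta> = point_load f h \<gamma>}"
      unfolding img[OF disjI1[OF imageI[OF \<gamma>]]] .
    then obtain \<delta> where \<delta>: "t ` orbit h \<gamma> = orbit g \<delta>" "\<delta> \<in> ?Y" "point_load e g \<delta> = point_load f h \<gamma>"
      by auto
    have "t \<gamma> \<in> orbit g \<delta>" using \<delta>(1) self_in_orbit[OF finite_base h] by blast
    then show ?thesis
      using \<delta> terr_orbit_closed[OF e g] point_load_orbit[OF e g] terr_subset_base[OF e g] by auto
  qed
  have bwd: "\<gamma> \<in> ?X" if \<gamma>: "t \<gamma> \<in> ?Y" for \<gamma>
  proof -
    have "orbit g (t \<gamma>) \<in> orbit g ` {\<delta> \<in> ?Y. point_load e g \<delta> = point_load e g (t \<gamma>)}"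
      using \<gamma> by blast
    then have "orbit g (t \<gamma>) \<in>
        image t ` orbit h ` {\<gamma>' \<in> ?X. point_load f h \<gamma>' = point_load e g (t \<gamma>)}"
      unfolding img[OF disjI2[OF imageI[OF \<gamma>]]] .
    then obtain \<gamma>' where \<gamma>': "\<gamma>' \<in> ?X" "t ` orbit h \<gamma> = t ` orbit h \<gamma>'"
      unfolding orbit_intertwine[OF inter] by auto
    have "t \<gamma> \<in> t ` orbit h \<gamma>'"
      using self_in_orbit[OF finite_base h, of \<gamma>] unfolding \<gamma>'(2)[symmetric] by blast
    then have "\<gamma> \<in> orbit h \<gamma>'" using permutes_inj[OF t] by (auto dest: injD)
    then show ?thesis using \<gamma>'(1) terr_orbit_closed[OF f h] by blast
  qed
  show ?R
  proof
    fix \<gamma> assume \<gamma>: "\<gamma> \<in> \<Gamma>"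
    show "point_load f h \<gamma> = point_load e g (t \<gamma>)"
    proof (cases "\<gamma> \<in> ?X")
      case False
      then have "t \<gamma> \<notin> ?Y" using bwd by blast
      then show ?thesis
        using False \<gamma> permutes_in_image[OF t, of \<gamma>] point_load_trivial_iff[OF f h]
          point_load_trivial_iff[OF e g] by metis
    qed (use fwd in blast)
  qed
qed

text \<open>
  For a fixed top component \<open>t\<close> of the conjugating element, everything is decided by loads: the base
  component \<open>s\<close> exists if and only if \<open>t\<close> preserves them.
\<close>

lemma conjugate_in_wreath_iff_point_load:
  assumes f: "f \<in> \<Gamma> \<rightarrow>\<^sub>E carrier K" and h: "h permutes \<Gamma>"
    and e: "e \<in> \<Gamma> \<rightarrow>\<^sub>E carrier K" and g: "g permutes \<Gamma>"
    and t: "t permutes \<Gamma>"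
  shows "(\<exists>s \<in> \<Gamma> \<rightarrow>\<^sub>E carrier K. conjugate (full_wreath K \<Gamma>) (f, h) (s, t) = (e, g)) \<longleftrightarrow>
    t \<circ> h = g \<circ> t \<and> (\<forall>\<gamma>\<in>\<Gamma>. point_load f h \<gamma> = point_load e g (t \<gamma>))"
proof
  assume "\<exists>s \<in> \<Gamma> \<rightarrow>\<^sub>E carrier K. conjugate (full_wreath K \<Gamma>) (f, h) (s, t) = (e, g)"
  then obtain s where s: "s \<in> \<Gamma> \<rightarrow>\<^sub>E carrier K" "t \<circ> h = g \<circ> t"
      "\<forall>\<gamma>\<in>\<Gamma>. f \<gamma> \<otimes> s (h \<gamma>) = s \<gamma> \<otimes> e (t \<gamma>)"
    using conjugate_wreath_eq_iff[OF f h _ t e g] by blast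
  then show "t \<circ> h = g \<circ> t \<and> (\<forall>\<gamma>\<in>\<Gamma>. point_load f h \<gamma> = point_load e g (t \<gamma>))"
    using point_load_conjugate[OF f h s(1) t e g s(2)] by blast
next
  assume *: "t \<circ> h = g \<circ> t \<and> (\<forall>\<gamma>\<in>\<Gamma>. point_load f h \<gamma> = point_load e g (t \<gamma>))"
  obtain s where "s \<in> \<Gamma> \<rightarrow>\<^sub>E carrier K"
      "\<And>\<gamma>. \<gamma> \<in> \<Gamma> \<Longrightarrow> f \<gamma> \<otimes> s (h \<gamma>) = s \<gamma> \<otimes> e (t \<gamma>)"
    by (rule conjugator_of_point_load[OF f h t e g]) (use * in auto)
  then show "\<exists>s \<in> \<Gamma> \<rightarrow>\<^sub>E carrier K. conjugate (full_wreath K \<Gamma>) (f, h) (s, t) = (e, g)"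
    using conjugate_wreath_eq_iff[OF f h _ t e g] * by blast
qed

lemma conjugate_in_wreath_iff:
  assumes f: "f \<in> \<Gamma> \<rightarrow>\<^sub>E carrier K" and h: "h permutes \<Gamma>"
    and e: "e \<in> \<Gamma> \<rightarrow>\<^sub>E carrier K" and g: "g permutes \<Gamma>"
    and H: "subgroup H (Sym \<Gamma>)"
  shows "(\<exists>a \<in> carrier (wreath K \<Gamma> H). conjugate (full_wreath K \<Gamma>) (f, h) a = (e, g)) \<longleftrightarrow>
    (\<exists>t \<in> H. conjugate (Sym \<Gamma>) h t = g \<and>
       decomp_act (terr_decomp K \<Gamma> (f, h)) t = terr_decomp K \<Gamma> (e, g))"
proof -
  have H_perm: "t permutes \<Gamma>" if "t \<in> H" for t
    using subgroup.mem_carrier[OF H that] by (simp add: Sym_def)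
  have "carrier (wreath K \<Gamma> H) = (\<Gamma> \<rightarrow>\<^sub>E carrier K) \<times> H" by (simp add: wreath_def)
  then have "(\<exists>a \<in> carrier (wreath K \<Gamma> H). conjugate (full_wreath K \<Gamma>) (f, h) a = (e, g)) \<longleftrightarrow>
    (\<exists>t \<in> H. \<exists>s \<in> \<Gamma> \<rightarrow>\<^sub>E carrier K. conjugate (full_wreath K \<Gamma>) (f, h) (s, t) = (e, g))"
    by auto
  also have "\<dots> \<longleftrightarrow> (\<exists>t \<in> H. conjugate (Sym \<Gamma>) h t = g \<and>
       decomp_act (terr_decomp K \<Gamma> (f, h)) t = terr_decomp K \<Gamma> (e, g))"
  proof (rule bex_cong[OF refl])
    fix t assume "t \<in> H"
    then have t: "t permutes \<Gamma>" by (rule H_perm)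
    show "(\<exists>s \<in> \<Gamma> \<rightarrow>\<^sub>E carrier K. conjugate (full_wreath K \<Gamma>) (f, h) (s, t) = (e, g)) \<longleftrightarrow>
      conjugate (Sym \<Gamma>) h t = g \<and>
       decomp_act (terr_decomp K \<Gamma> (f, h)) t = terr_decomp K \<Gamma> (e, g)"
      unfolding conjugate_in_wreath_iff_point_load[OF f h e g t] conjugate_Sym_eq_iff[OF h t g]
      using decomp_act_eq_iff[OF f h e g t] by blast
  qed
  finally show ?thesis .
qed

section \<open>Elements with a prescribed top component and prescribed loads\<close>

text \<open>
  \<open>glue\<close> reassembles a base component from its coordinates: the orbit products \<open>x\<close> at the chosen
  points and the values \<open>d\<close> at the other points of the orbits. The value at a chosen point is the
  unique solution of \<open>y \<cdot> d\<^sub>1 \<cdots> d\<^sub>m = x\<close>, where \<open>d\<^sub>1, \<dots>, d\<^sub>m\<close> are the values met along the rest of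
  the orbit. For a fixed point of \<open>h\<close> the product is empty and the value is \<open>x\<close> itself.
\<close>

definition glue ::
    "('a \<Rightarrow> 'k) \<Rightarrow> ('a \<Rightarrow> 'a) \<Rightarrow> (('a \<Rightarrow> 'k) \<times> ('a \<Rightarrow> 'a) \<Rightarrow> 'a)
      \<Rightarrow> (('a \<Rightarrow> 'k) \<times> ('a \<Rightarrow> 'a) \<Rightarrow> 'k) \<Rightarrow> (('a \<Rightarrow> 'k) \<times> ('a \<Rightarrow> 'a) \<Rightarrow> 'a \<Rightarrow> 'k) \<Rightarrow> 'a \<Rightarrow> 'k" where
  "glue f h pt x d = (\<lambda>\<gamma>\<in>\<Gamma>.
     if \<gamma> \<notin> terr K \<Gamma> (f, h) then \<one>
     else let z = orbit_cycle f h \<gamma> in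
       if \<gamma> = pt z
       then x z \<otimes> inv (ordered_prod K (map (\<lambda>i. d z ((h ^^ i) \<gamma>)) [1..<card (orbit h \<gamma>)]))
       else d z \<gamma>)"

definition same_loads :: "('a \<Rightarrow> 'k) \<Rightarrow> ('a \<Rightarrow> 'a) \<Rightarrow> ('a \<Rightarrow> 'k) set" where
  "same_loads f h = {e \<in> \<Gamma> \<rightarrow>\<^sub>E carrier K. \<forall>\<gamma>\<in>\<Gamma>. point_load e h \<gamma> = point_load f h \<gamma>}"

lemma orbit_prod_split_first:
  assumes "h permutes \<Gamma>"
  shows "orbit_prod f h \<gamma> =
    f \<gamma> \<otimes> ordered_prod K (map (\<lambda>i. f ((h ^^ i) \<gamma>)) [1..<card (orbit h \<gamma>)])"
  unfolding orbit_prod_def path_prod_def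
  using card_orbit_pos[OF finite_base assms] by (simp add: upt_conv_Cons)

context
  fixes f h pt
  assumes f: "f \<in> \<Gamma> \<rightarrow>\<^sub>E carrier K" and h: "h permutes \<Gamma>"
    and pt: "\<And>z. z \<in> wreath_cycles K \<Gamma> (f, h) \<Longrightarrow> pt z \<in> terr K \<Gamma> z"
begin

abbreviation (input) "cycle_of \<equiv> orbit_cycle f h"
abbreviation (input) "territory \<equiv> terr K \<Gamma> (f, h)"
abbreviation (input) "coords \<equiv>
  (\<Pi>\<^sub>E z\<in>wreath_cycles K \<Gamma> (f, h). conj_class K (carrier K) (Yade K \<Gamma> (pt z) z))"
abbreviation (input) "tails \<equiv>
  (\<Pi>\<^sub>E z\<in>top_wreath_cycles K \<Gamma> (f, h). (supp (snd z) - {pt z}) \<rightarrow>\<^sub>E carrier K)"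

lemma pt_in_orbit:
  assumes "\<gamma> \<in> territory"
  shows "pt (cycle_of \<gamma>) \<in> orbit h \<gamma>"
  using pt[of "cycle_of \<gamma>"] assms terr_orbit_cycle[OF f h assms] wreath_cycles_eq_orbit_cycles[OF f h]
  by simp

lemma cycle_at_pt:
  assumes "z \<in> wreath_cycles K \<Gamma> (f, h)"
  shows "pt z \<in> territory" "pt z \<in> \<Gamma>" "cycle_of (pt z) = z"
proof -
  obtain \<gamma> where \<gamma>: "\<gamma> \<in> territory" "z = cycle_of \<gamma>"
    using assms wreath_cycles_eq_orbit_cycles[OF f h] by auto
  have *: "pt z \<in> orbit h \<gamma>" unfolding \<gamma>(2) by (rule pt_in_orbit[OF \<gamma>(1)])
  show "cycle_of (pt z) = z" unfolding \<gamma>(2) by (rule orbit_cycle_eq[OF f h *[unfolded \<gamma>(2)]])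
  show "pt z \<in> territory" by (rule terr_orbit_closed[OF f h \<gamma>(1) *])
  then show "pt z \<in> \<Gamma>" using terr_subset_base[OF f h] by blast
qed

lemma cycle_mem: "\<gamma> \<in> territory \<Longrightarrow> cycle_of \<gamma> \<in> wreath_cycles K \<Gamma> (f, h)"
  using wreath_cycles_eq_orbit_cycles[OF f h] by simp

lemma cycle_top:
  assumes "\<gamma> \<in> territory" "\<gamma> \<noteq> pt (cycle_of \<gamma>)"
  shows "cycle_of \<gamma> \<in> top_wreath_cycles K \<Gamma> (f, h)" "\<gamma> \<in> supp (snd (cycle_of \<gamma>)) - {pt (cycle_of \<gamma>)}"
proof -
  have "h \<gamma> \<noteq> \<gamma>"
    using pt_in_orbit[OF assms(1)] assms(2) orbit_cycle_fixed(2)[OF f h, of \<gamma>] by auto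
  then have s: "supp (snd (cycle_of \<gamma>)) = orbit h \<gamma>" using supp_orbit_cycle[OF f h, of \<gamma>] by simp
  show 2: "\<gamma> \<in> supp (snd (cycle_of \<gamma>)) - {pt (cycle_of \<gamma>)}"
    unfolding s using self_in_orbit[OF finite_base h] assms(2) by simp
  then have "snd (cycle_of \<gamma>) \<noteq> id" by (auto simp: supp_def)
  then show "cycle_of \<gamma> \<in> top_wreath_cycles K \<Gamma> (f, h)"
    using cycle_mem[OF assms(1)] by (simp add: top_wreath_cycles_def)
qed

lemma cycle_at_supp:
  assumes "z \<in> top_wreath_cycles K \<Gamma> (f, h)" "\<gamma> \<in> supp (snd z)"
  shows "\<gamma> \<in> territory" "cycle_of \<gamma> = z"
proof -
  obtain \<beta> where \<beta>: "\<beta> \<in> territory" "z = cycle_of \<beta>"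
    using assms(1) wreath_cycles_eq_orbit_cycles[OF f h] by (auto simp: top_wreath_cycles_def)
  have *: "\<gamma> \<in> orbit h \<beta>"
    using assms(2) supp_orbit_cycle[OF f h, of \<beta>] unfolding \<beta>(2) by (auto split: if_splits)
  show "cycle_of \<gamma> = z" unfolding \<beta>(2) by (rule orbit_cycle_eq[OF f h *])
  show "\<gamma> \<in> territory" by (rule terr_orbit_closed[OF f h \<beta>(1) *])
qed

lemma Yade_at_pt:
  assumes "z \<in> wreath_cycles K \<Gamma> (f, h)"
  shows "Yade K \<Gamma> (pt z) z = orbit_prod f h (pt z)"
  using Yade_orbit_cycle[OF f h cycle_at_pt(2)[OF assms] self_in_orbit[OF finite_base h]]
  unfolding cycle_at_pt(3)[OF assms] .

text \<open>
  Loads are constant on orbits, so inside the territory it suffices to compare them at the chosen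
  points; outside, both loads are trivial.
\<close>

lemma point_loads_from_pts:
  assumes e: "e \<in> \<Gamma> \<rightarrow>\<^sub>E carrier K"
    and out: "\<And>\<gamma>. \<gamma> \<in> \<Gamma> - territory \<Longrightarrow> e \<gamma> = \<one>"
    and at_pt: "\<And>z. z \<in> wreath_cycles K \<Gamma> (f, h) \<Longrightarrow>
      orbit_prod e h (pt z) \<in> conj_class K (carrier K) (Yade K \<Gamma> (pt z) z)"
  shows "e \<in> same_loads f h"
proof -
  have "point_load e h \<gamma> = point_load f h \<gamma>" if \<gamma>: "\<gamma> \<in> \<Gamma>" for \<gamma>
  proof (cases "\<gamma> \<in> territory")
    case True
    let ?p = "pt (cycle_of \<gamma>)"
    note z = cycle_mem[OF True]
    note p = pt_in_orbit[OF True]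
    have "conj_class K (carrier K) (orbit_prod e h ?p) = conj_class K (carrier K) (orbit_prod f h ?p)"
      using at_pt[OF z] mem_conj_class_iff_eq[OF orbit_prod_closed[OF f h cycle_at_pt(2)[OF z]]]
      unfolding Yade_at_pt[OF z] by blast
    then have "point_load e h ?p = point_load f h ?p" by (simp add: point_load_def)
    then show ?thesis using point_load_orbit[OF e h \<gamma> p] point_load_orbit[OF f h \<gamma> p] by simp
  next
    case False
    then have "\<gamma> \<notin> terr K \<Gamma> (e, h)" using out \<gamma> by (auto simp: terr_def)
    then show ?thesis
      using point_load_trivial_iff[OF e h \<gamma>] point_load_trivial_iff[OF f h \<gamma>] False by simp
  qed
  then show ?thesis using e by (simp add: same_loads_def)
qed

context
  fixes x d
  assumes x: "x \<in> coords" and d: "d \<in> tails"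
begin

lemma coord_closed: "z \<in> wreath_cycles K \<Gamma> (f, h) \<Longrightarrow> x z \<in> carrier K"
  using PiE_mem[OF x, of z] Yade_at_pt[of z] cycle_at_pt(2)[of z]
    mem_conj_class_iff_eq[OF orbit_prod_closed[OF f h]] by auto

lemma tail_closed:
  "z \<in> top_wreath_cycles K \<Gamma> (f, h) \<Longrightarrow> \<gamma> \<in> supp (snd z) - {pt z} \<Longrightarrow> d z \<gamma> \<in> carrier K"
  by (rule PiE_mem[OF PiE_mem[OF d]])

text \<open>
  These are the points at which \<open>glue\<close> evaluates \<open>d\<close> when it solves for the value at \<open>pt z\<close>; they
  have to lie in the domain of \<open>d z\<close>.
\<close>

lemma orbit_past_pt:
  assumes z: "z \<in> wreath_cycles K \<Gamma> (f, h)" and i: "0 < i" "i < card (orbit h (pt z))"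
  shows "z \<in> top_wreath_cycles K \<Gamma> (f, h)" "(h ^^ i) (pt z) \<in> supp (snd z) - {pt z}"
    "(h ^^ i) (pt z) \<in> territory" "cycle_of ((h ^^ i) (pt z)) = z" "(h ^^ i) (pt z) \<in> \<Gamma>"
proof -
  let ?\<gamma> = "(h ^^ i) (pt z)"
  have orb: "?\<gamma> \<in> orbit h (pt z)" by (rule funpow_in_orbit[OF self_in_orbit[OF finite_base h]])
  show c: "cycle_of ?\<gamma> = z" using orbit_cycle_eq[OF f h orb] cycle_at_pt(3)[OF z] by simp
  show territory: "?\<gamma> \<in> territory" by (rule terr_orbit_closed[OF f h cycle_at_pt(1)[OF z] orb])
  show "?\<gamma> \<in> \<Gamma>" using territory terr_subset_base[OF f h] by blast
  have "?\<gamma> \<noteq> pt z"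
    using i funpow_fixes_iff_card_orbit_dvd[OF finite_base h, of i "pt z"] by (auto dest: dvd_imp_le)
  then have "?\<gamma> \<noteq> pt (cycle_of ?\<gamma>)" unfolding c .
  from cycle_top[OF territory this] show "z \<in> top_wreath_cycles K \<Gamma> (f, h)" "?\<gamma> \<in> supp (snd z) - {pt z}"
    unfolding c by auto
qed

lemma glue_at_pt:
  assumes z: "z \<in> wreath_cycles K \<Gamma> (f, h)"
  shows "glue f h pt x d (pt z) =
    x z \<otimes> inv (ordered_prod K (map (\<lambda>i. d z ((h ^^ i) (pt z))) [1..<card (orbit h (pt z))]))"
  using cycle_at_pt[OF z] by (simp add: glue_def)

lemma glue_off_pt:
  assumes "z \<in> top_wreath_cycles K \<Gamma> (f, h)" "\<gamma> \<in> supp (snd z) - {pt z}"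
  shows "glue f h pt x d \<gamma> = d z \<gamma>"
proof -
  have \<gamma>: "\<gamma> \<in> territory" "cycle_of \<gamma> = z" using cycle_at_supp[OF assms(1)] assms(2) by auto
  then have "\<gamma> \<in> \<Gamma>" using terr_subset_base[OF f h] by blast
  then show ?thesis using \<gamma> assms(2) by (simp add: glue_def)
qed

lemma tail_list_closed:
  assumes z: "z \<in> wreath_cycles K \<Gamma> (f, h)"
  shows "set (map (\<lambda>i. d z ((h ^^ i) (pt z))) [1..<card (orbit h (pt z))]) \<subseteq> carrier K"
proof -
  have "d z ((h ^^ i) (pt z)) \<in> carrier K" if "i \<in> set [1..<card (orbit h (pt z))]" for i
    by (rule tail_closed[OF orbit_past_pt(1,2)[OF z, of i]]) (use that in auto)
  then show ?thesis by auto
qed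

lemma glue_closed: "glue f h pt x d \<in> \<Gamma> \<rightarrow>\<^sub>E carrier K"
proof (rule PiE_I)
  fix \<gamma> assume \<gamma>: "\<gamma> \<in> \<Gamma>"
  consider "\<gamma> \<notin> territory" | "\<gamma> \<in> territory" "\<gamma> = pt (cycle_of \<gamma>)" | "\<gamma> \<in> territory" "\<gamma> \<noteq> pt (cycle_of \<gamma>)" by blast
  then show "glue f h pt x d \<gamma> \<in> carrier K"
  proof cases
    case 1
    then show ?thesis using \<gamma> by (simp add: glue_def)
  next
    case 2
    note z = cycle_mem[OF 2(1)]
    have "glue f h pt x d \<gamma> = glue f h pt x d (pt (cycle_of \<gamma>))" using 2(2) by (rule arg_cong)
    then show ?thesis
      unfolding glue_at_pt[OF z]
      using coord_closed[OF z] ordered_prod_closed[OF tail_list_closed[OF z]] by simp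
  next
    case 3
    show ?thesis
      unfolding glue_off_pt[OF cycle_top[OF 3]] by (rule tail_closed[OF cycle_top[OF 3]])
  qed
qed (simp add: glue_def)

lemma orbit_prod_glue:
  assumes z: "z \<in> wreath_cycles K \<Gamma> (f, h)"
  shows "orbit_prod (glue f h pt x d) h (pt z) = x z"
proof -
  let ?n = "card (orbit h (pt z))"
  let ?l = "map (\<lambda>i. d z ((h ^^ i) (pt z))) [1..<?n]"
  have l: "map (\<lambda>i. glue f h pt x d ((h ^^ i) (pt z))) [1..<?n] = ?l"
  proof (intro map_cong refl)
    fix i assume "i \<in> set [1..<?n]"
    then show "glue f h pt x d ((h ^^ i) (pt z)) = d z ((h ^^ i) (pt z))"
      by (intro glue_off_pt orbit_past_pt(1,2)[OF z, of i]) auto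
  qed
  show ?thesis
    unfolding orbit_prod_split_first[OF h] glue_at_pt[OF z] l
    using coord_closed[OF z] ordered_prod_closed[OF tail_list_closed[OF z]] by (simp add: m_assoc)
qed

lemma glue_same_loads: "glue f h pt x d \<in> same_loads f h"
proof (rule point_loads_from_pts[OF glue_closed])
  show "glue f h pt x d \<gamma> = \<one>" if "\<gamma> \<in> \<Gamma> - territory" for \<gamma> using that by (simp add: glue_def)
  show "orbit_prod (glue f h pt x d) h (pt z) \<in> conj_class K (carrier K) (Yade K \<Gamma> (pt z) z)"
    if "z \<in> wreath_cycles K \<Gamma> (f, h)" for z
    unfolding orbit_prod_glue[OF that] by (rule PiE_mem[OF x that])
qed

end

text \<open>
  The inverse reads off the orbit products at the chosen points and the values at the remaining
  points of the non-trivial orbits.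
\<close>

lemma bij_betw_glue:
  "bij_betw (\<lambda>(x, d). glue f h pt x d) (coords \<times> tails) (same_loads f h)"
proof (rule bij_betw_byWitness[where f' = "\<lambda>e.
      (\<lambda>z\<in>wreath_cycles K \<Gamma> (f, h). orbit_prod e h (pt z),
       \<lambda>z\<in>top_wreath_cycles K \<Gamma> (f, h). restrict e (supp (snd z) - {pt z}))"])
  let ?C = "wreath_cycles K \<Gamma> (f, h)" and ?T = "top_wreath_cycles K \<Gamma> (f, h)"
  have left: "(\<lambda>z\<in>?C. orbit_prod (glue f h pt x d) h (pt z)) = x"
      "(\<lambda>z\<in>?T. restrict (glue f h pt x d) (supp (snd z) - {pt z})) = d"
    if xd: "x \<in> coords" "d \<in> tails" for x d
  proof -
    show "(\<lambda>z\<in>?C. orbit_prod (glue f h pt x d) h (pt z)) = x"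
      using xd(1) orbit_prod_glue[OF xd] by (intro extensionalityI[of _ ?C]) (auto simp: PiE_def)
    show "(\<lambda>z\<in>?T. restrict (glue f h pt x d) (supp (snd z) - {pt z})) = d"
    proof (rule extensionalityI[of _ ?T])
      fix z assume z: "z \<in> ?T"
      have "d z \<in> extensional (supp (snd z) - {pt z})"
        using PiE_mem[OF xd(2) z] by (simp add: PiE_def)
      then have "restrict (glue f h pt x d) (supp (snd z) - {pt z}) = d z"
        using glue_off_pt[OF xd z] by (intro extensionalityI[of _ "supp (snd z) - {pt z}"]) auto
      then show "(\<lambda>z\<in>?T. restrict (glue f h pt x d) (supp (snd z) - {pt z})) z = d z"
        using z by simp
    qed (use xd(2) in \<open>auto simp: PiE_def\<close>)
  qed
  then show "\<forall>a\<in>coords \<times> tails.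
      ((\<lambda>z\<in>?C. orbit_prod ((\<lambda>(x, d). glue f h pt x d) a) h (pt z)),
       (\<lambda>z\<in>?T. restrict ((\<lambda>(x, d). glue f h pt x d) a) (supp (snd z) - {pt z}))) = a"
    by (auto simp del: restrict_apply)
  show "(\<lambda>(x, d). glue f h pt x d) ` (coords \<times> tails) \<subseteq> same_loads f h"
    using glue_same_loads by auto
  have inv_coord: "(\<lambda>z\<in>?C. orbit_prod e h (pt z)) \<in> coords" if e: "e \<in> same_loads f h" for e
  proof (rule PiE_I)
    fix z assume z: "z \<in> ?C"
    note p = cycle_at_pt(2)[OF z]
    have e': "e \<in> \<Gamma> \<rightarrow>\<^sub>E carrier K" "point_load e h (pt z) = point_load f h (pt z)"
      using e p by (auto simp: same_loads_def)
    then show "(\<lambda>z\<in>?C. orbit_prod e h (pt z)) z \<in> conj_class K (carrier K) (Yade K \<Gamma> (pt z) z)"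
      using z mem_conj_class_iff_eq[OF orbit_prod_closed[OF f h p]] orbit_prod_closed[OF e'(1) h p]
      by (simp add: Yade_at_pt[OF z] point_load_def)
  qed simp
  have inv_tail: "(\<lambda>z\<in>?T. restrict e (supp (snd z) - {pt z})) \<in> tails"
    if e: "e \<in> same_loads f h" for e
  proof (rule PiE_I)
    fix z assume z: "z \<in> ?T"
    have "e \<gamma> \<in> carrier K" if "\<gamma> \<in> supp (snd z)" for \<gamma>
    proof -
      have "\<gamma> \<in> \<Gamma>" using cycle_at_supp(1)[OF z that] terr_subset_base[OF f h] by blast
      then show ?thesis using e base_value_closed by (auto simp: same_loads_def)
    qed
    then show "(\<lambda>z\<in>?T. restrict e (supp (snd z) - {pt z})) z \<in> (supp (snd z) - {pt z}) \<rightarrow>\<^sub>E carrier K"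
      using z by auto
  qed simp
  show "(\<lambda>e. (\<lambda>z\<in>?C. orbit_prod e h (pt z), \<lambda>z\<in>?T. restrict e (supp (snd z) - {pt z}))) `
      same_loads f h \<subseteq> coords \<times> tails"
    using inv_coord inv_tail by blast
  show "\<forall>e\<in>same_loads f h. (\<lambda>(x, d). glue f h pt x d)
      ((\<lambda>z\<in>?C. orbit_prod e h (pt z)), (\<lambda>z\<in>?T. restrict e (supp (snd z) - {pt z}))) = e"
  proof
    fix e assume e: "e \<in> same_loads f h"
    define x where "x = (\<lambda>z\<in>?C. orbit_prod e h (pt z))"
    define d where "d = (\<lambda>z\<in>?T. restrict e (supp (snd z) - {pt z}))"
    have xd: "x \<in> coords" "d \<in> tails" unfolding x_def d_def using inv_coord inv_tail e by auto
    have e': "e \<in> \<Gamma> \<rightarrow>\<^sub>E carrier K" using e by (simp add: same_loads_def)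
    have "glue f h pt x d = e"
    proof (rule extensionalityI[of _ \<Gamma>])
      fix \<gamma> assume \<gamma>: "\<gamma> \<in> \<Gamma>"
      consider "\<gamma> \<notin> territory" | "\<gamma> \<in> territory" "\<gamma> = pt (cycle_of \<gamma>)" | "\<gamma> \<in> territory" "\<gamma> \<noteq> pt (cycle_of \<gamma>)" by blast
      then show "glue f h pt x d \<gamma> = e \<gamma>"
      proof cases
        case 1
        then have "\<gamma> \<notin> terr K \<Gamma> (e, h)"
          using e \<gamma> point_load_trivial_iff[OF e' h \<gamma>] point_load_trivial_iff[OF f h \<gamma>]
          by (auto simp: same_loads_def)
        then show ?thesis using 1 \<gamma> by (auto simp: glue_def terr_def)
      next
        case 2
        define z where "z = cycle_of \<gamma>"
        have \<gamma>z: "\<gamma> = pt z" using 2(2) by (simp add: z_def)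
        have z: "z \<in> ?C" unfolding z_def by (rule cycle_mem[OF 2(1)])
        let ?n = "card (orbit h (pt z))"
        let ?l = "map (\<lambda>i. d z ((h ^^ i) (pt z))) [1..<?n]"
        have l: "map (\<lambda>i. e ((h ^^ i) (pt z))) [1..<?n] = ?l"
        proof (intro map_cong refl)
          fix i assume "i \<in> set [1..<?n]"
          then show "e ((h ^^ i) (pt z)) = d z ((h ^^ i) (pt z))"
            using orbit_past_pt(1,2)[OF xd z, of i] by (simp add: d_def)
        qed
        have "x z = e (pt z) \<otimes> ordered_prod K ?l"
          using z orbit_prod_split_first[OF h, of e "pt z"] unfolding l by (simp add: x_def)
        then show ?thesis
          unfolding \<gamma>z glue_at_pt[OF xd z]
          using base_value_closed[OF e' \<gamma>] ordered_prod_closed[OF tail_list_closed[OF xd z]]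
          by (simp add: m_assoc \<gamma>z)
      next
        case 3
        show ?thesis
          unfolding glue_off_pt[OF xd cycle_top[OF 3]] using cycle_top[OF 3] by (simp add: d_def)
      qed
    qed (use glue_closed[OF xd] e' in \<open>auto simp: PiE_def\<close>)
    then show "(\<lambda>(x, d). glue f h pt x d)
      ((\<lambda>z\<in>?C. orbit_prod e h (pt z)), (\<lambda>z\<in>?T. restrict e (supp (snd z) - {pt z}))) = e"
      unfolding x_def d_def by simp
  qed
qed

end

end

lemma decomp_act_comp: "decomp_act (decomp_act P s) t = decomp_act P (t \<circ> s)"
  by (auto simp: decomp_act_def fun_eq_iff option.map_comp comp_def image_image)

lemma decomp_act_id: "decomp_act P id = P"
  by (simp add: decomp_act_def option.map_id id_def[symmetric] fun_eq_iff)

lemma decomp_act_cancel: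
  assumes "t permutes \<Gamma>" "decomp_act P t = decomp_act Q t"
  shows "P = Q"
proof -
  have "decomp_act (decomp_act R t) (inv_into UNIV t) = R" for R :: "'l \<rightharpoonup> 'a set set"
    using permutes_inv_o(2)[OF assms(1)] by (simp add: decomp_act_comp decomp_act_id)
  then show ?thesis using assms(2) by metis
qed

context wreath_base
begin

lemma fun_act_eq:
  assumes "t permutes \<Gamma>" "\<gamma> \<in> \<Gamma>"
  shows "fun_act \<Gamma> f t (t \<gamma>) = f \<gamma>"
  using assms permutes_in_image[OF assms(1), of \<gamma>] permutes_inverses(2)[OF assms(1)]
  by (simp add: fun_act_def inv_Sym)

lemma fun_act_closed:
  assumes "t permutes \<Gamma>" "f \<in> \<Gamma> \<rightarrow>\<^sub>E carrier K"
  shows "fun_act \<Gamma> f t \<in> \<Gamma> \<rightarrow>\<^sub>E carrier K"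
  using assms permutes_in_image[OF permutes_inv[OF assms(1)]]
  by (auto simp: fun_act_def inv_Sym PiE_iff)

lemma base_point_preimage:
  assumes "t permutes \<Gamma>" "\<epsilon> \<in> \<Gamma>"
  obtains \<gamma> where "\<gamma> \<in> \<Gamma>" "\<epsilon> = t \<gamma>"
  using assms permutes_image by (metis imageE)

text \<open>
  Relabelling the points by \<open>b\<close> is conjugation by \<open>(1, b)\<close>.
\<close>

lemma point_load_fun_act:
  assumes e: "e \<in> \<Gamma> \<rightarrow>\<^sub>E carrier K" and h: "h permutes \<Gamma>" and b: "b permutes \<Gamma>"
    and k: "k permutes \<Gamma>" and inter: "b \<circ> h = k \<circ> b" and \<gamma>: "\<gamma> \<in> \<Gamma>"
  shows "point_load (fun_act \<Gamma> e b) k (b \<gamma>) = point_load e h \<gamma>"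
proof (rule point_load_conjugate[symmetric, where s = "\<lambda>\<gamma>\<in>\<Gamma>. \<one>"])
  fix \<delta> assume "\<delta> \<in> \<Gamma>"
  then show "e \<delta> \<otimes> (\<lambda>\<gamma>\<in>\<Gamma>. \<one>) (h \<delta>) = (\<lambda>\<gamma>\<in>\<Gamma>. \<one>) \<delta> \<otimes> fun_act \<Gamma> e b (b \<delta>)"
    using permutes_in_image[OF h] base_value_closed[OF e] by (simp add: fun_act_eq[OF b])
qed (use assms fun_act_closed in auto)

section \<open>Parametrising the class by top component, decomposition and loads\<close>

definition transversal_elt :: "('a \<Rightarrow> 'a) set \<Rightarrow> ('a \<Rightarrow> 'a) \<Rightarrow> ('a \<Rightarrow> 'a) \<Rightarrow> 'a \<Rightarrow> 'a" where
  "transversal_elt T h k = (THE t. t \<in> T \<and> conjugate (Sym \<Gamma>) h t = k)"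

text \<open>
  The element \<open>b = c t\<close> by which the class map relabels the points.
\<close>

definition class_conjugator ::
    "('a \<Rightarrow> 'a) set \<Rightarrow> ('a \<Rightarrow> 'a) \<Rightarrow> (('k set \<times> nat \<rightharpoonup> 'a set set) \<Rightarrow> ('a \<Rightarrow> 'a))
      \<Rightarrow> ('a \<Rightarrow> 'a) \<Rightarrow> ('k set \<times> nat \<rightharpoonup> 'a set set) \<Rightarrow> 'a \<Rightarrow> 'a" where
  "class_conjugator T h rep k Q = rep Q \<otimes>\<^bsub>Sym \<Gamma>\<^esub> transversal_elt T h k"

context
  fixes f h H T and rep :: "('k set \<times> nat \<rightharpoonup> 'a set set) \<Rightarrow> ('a \<Rightarrow> 'a)"
  assumes f: "f \<in> \<Gamma> \<rightarrow>\<^sub>E carrier K" and h: "h permutes \<Gamma>" and H: "subgroup H (Sym \<Gamma>)"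
    and T: "right_transversal ((Sym \<Gamma>)\<lparr>carrier := H\<rparr>) (centralizer (Sym \<Gamma>) H h) T"
    and rep: "\<And>Q. Q \<in> decomp_orbit K \<Gamma> H (f, h) \<Longrightarrow>
      rep Q \<in> centralizer (Sym \<Gamma>) H h \<and> decomp_act (terr_decomp K \<Gamma> (f, h)) (rep Q) = Q"
begin

abbreviation (input) "tops \<equiv> conj_class (Sym \<Gamma>) H h"
abbreviation (input) "decompositions \<equiv> decomp_orbit K \<Gamma> H (f, h)"
abbreviation (input) "decomposition \<equiv> terr_decomp K \<Gamma> (f, h)"

abbreviation (input) "transversal_elt_of \<equiv> transversal_elt T h"
abbreviation (input) "conjugator \<equiv> class_conjugator T h rep"

lemma H_permutes: "t \<in> H \<Longrightarrow> t permutes \<Gamma>"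
  using subgroup.mem_carrier[OF H] by (simp add: Sym_def)

lemma H_comp: "s \<in> H \<Longrightarrow> t \<in> H \<Longrightarrow> t \<circ> s \<in> H"
  using subgroup.m_closed[OF H, of s t] by (simp add: Sym_def)

lemma H_inv: "t \<in> H \<Longrightarrow> inv_into UNIV t \<in> H"
  using subgroup.m_inv_closed[OF H, of t] H_permutes by (simp add: inv_Sym)

lemma mem_centralizer: "c \<in> centralizer (Sym \<Gamma>) H h \<longleftrightarrow> c \<in> H \<and> c \<circ> h = h \<circ> c"
  by (auto simp: centralizer_def Sym_def)

lemma mem_top_class:
  assumes "k \<in> tops"
  shows "k permutes \<Gamma>"
proof -
  obtain t where t: "t \<in> H" "k = conjugate (Sym \<Gamma>) h t" using assms by (auto simp: conj_class_def)
  then show ?thesis using H_permutes[OF t(1)] h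
    by (simp add: conjugate_def inv_Sym) (simp add: Sym_def permutes_compose permutes_inv)
qed

lemma transversal_elt_conjugates:
  assumes "k \<in> tops"
  shows "transversal_elt_of k \<in> H" "transversal_elt_of k \<circ> h = k \<circ> transversal_elt_of k"
proof -
  have "\<exists>!t. t \<in> T \<and> conjugate (Sym \<Gamma>) h t = k"
    by (rule right_transversal_conjugate[OF group_Sym H _ T assms]) (use h in \<open>simp add: Sym_def\<close>)
  from theI'[OF this] have *: "transversal_elt_of k \<in> T" "conjugate (Sym \<Gamma>) h (transversal_elt_of k) = k"
    by (simp_all add: transversal_elt_def)
  show "transversal_elt_of k \<in> H" using *(1) T by (auto simp: right_transversal_def)
  then show "transversal_elt_of k \<circ> h = k \<circ> transversal_elt_of k"
    using *(2) conjugate_Sym_eq_iff[OF h H_permutes mem_top_class[OF assms]] by simp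
qed

lemma class_conjugator_props:
  assumes k: "k \<in> tops" and Q: "Q \<in> decompositions"
  shows "conjugator k Q \<in> H" "conjugator k Q permutes \<Gamma>" "conjugator k Q \<circ> h = k \<circ> conjugator k Q"
    "decomp_act decomposition (conjugator k Q) = decomp_act Q (transversal_elt_of k)"
proof -
  have eq: "conjugator k Q = transversal_elt_of k \<circ> rep Q" by (simp add: class_conjugator_def Sym_def)
  have r: "rep Q \<in> H" "rep Q \<circ> h = h \<circ> rep Q" "decomp_act decomposition (rep Q) = Q"
    using rep[OF Q] by (auto simp: mem_centralizer)
  show "conjugator k Q \<in> H" unfolding eq by (rule H_comp[OF r(1) transversal_elt_conjugates(1)[OF k]])
  then show "conjugator k Q permutes \<Gamma>" by (rule H_permutes)
  show "conjugator k Q \<circ> h = k \<circ> conjugator k Q"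
    unfolding eq using r(2) transversal_elt_conjugates(2)[OF k] by (metis comp_assoc)
  show "decomp_act decomposition (conjugator k Q) = decomp_act Q (transversal_elt_of k)"
    unfolding eq by (simp only: decomp_act_comp[symmetric] r(3))
qed

text \<open>
  The image of \<open>(k, Q, e)\<close> has \<open>P(w)\<^sup>b\<close> as territory decomposition, because \<open>e\<close> has the same loads
  as \<open>f\<close>. So the image determines first \<open>k\<close> and with it \<open>t\<close>, then \<open>Q\<close> from \<open>Q\<^sup>t = P(w)\<^sup>b\<close> and with
  it \<open>b\<close>, and finally \<open>e\<close>. For surjectivity, part (a)
  yields a conjugating \<open>t'\<close> for every element of the class; correcting it by the transversal gives an
  element of the centralizer, hence an element \<open>Q\<close> of the orbit, and replacing \<open>t'\<close> by \<open>b\<close> does not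
  change the action on the decomposition.
\<close>

lemma bij_betw_relabel:
  "bij_betw (\<lambda>(k, Q, e). (fun_act \<Gamma> e (conjugator k Q), k))
    (tops \<times> decompositions \<times> same_loads f h)
    (conj_class (full_wreath K \<Gamma>) (carrier (wreath K \<Gamma> H)) (f, h))"
    (is "bij_betw ?F ?A ?B")
proof (rule bij_betw_imageI)
  have decomp: "decomp_act decomposition (conjugator k Q) = terr_decomp K \<Gamma> (fun_act \<Gamma> e (conjugator k Q), k)"
    if "k \<in> tops" "Q \<in> decompositions" "e \<in> same_loads f h" for k Q e
  proof -
    have e: "e \<in> \<Gamma> \<rightarrow>\<^sub>E carrier K" "\<forall>\<gamma>\<in>\<Gamma>. point_load e h \<gamma> = point_load f h \<gamma>"
      using that(3) by (auto simp: same_loads_def)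
    note b = class_conjugator_props[OF that(1,2)]
    note k = mem_top_class[OF that(1)]
    show ?thesis
      unfolding decomp_act_eq_iff[OF f h fun_act_closed[OF b(2) e(1)] k b(2,3)]
      using point_load_fun_act[OF e(1) h b(2) k b(3)] e(2) by simp
  qed
  show "inj_on ?F ?A"
  proof (rule inj_onI)
    fix p p' assume p: "p \<in> ?A" "p' \<in> ?A" "?F p = ?F p'"
    obtain k Q e where p1: "p = (k, Q, e)" by (cases p)
    obtain k' Q' e' where p2: "p' = (k', Q', e')" by (cases p')
    have k: "k' = k" using p(3) by (simp add: p1 p2)
    have m: "k \<in> tops" "Q \<in> decompositions" "e \<in> same_loads f h" "k \<in> tops" "Q' \<in> decompositions"
      "e' \<in> same_loads f h"
      and eq: "fun_act \<Gamma> e (conjugator k Q) = fun_act \<Gamma> e' (conjugator k Q')"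
      using p by (simp_all add: p1 p2 k)
    have "decomp_act decomposition (conjugator k Q) = decomp_act decomposition (conjugator k Q')"
      using decomp[OF m(1,2,3)] decomp[OF m(1,5,6)] eq by simp
    then have "decomp_act Q (transversal_elt_of k) = decomp_act Q' (transversal_elt_of k)"
      unfolding class_conjugator_props(4)[OF m(1,2)] class_conjugator_props(4)[OF m(1,5)] .
    then have Q: "Q = Q'" by (rule decomp_act_cancel[OF H_permutes[OF transversal_elt_conjugates(1)[OF m(1)]]])
    have "e = e'"
    proof (rule extensionalityI[of _ \<Gamma>])
      fix \<gamma> assume "\<gamma> \<in> \<Gamma>"
      then show "e \<gamma> = e' \<gamma>"
        using fun_cong[OF eq, of "conjugator k Q \<gamma>"] class_conjugator_props(2)[OF m(1,2)]
        by (simp add: Q fun_act_eq)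
    qed (use m in \<open>auto simp: same_loads_def PiE_def\<close>)
    then show "p = p'" by (simp add: p1 p2 k Q)
  qed
  show "?F ` ?A = ?B"
  proof (intro Set.equalityI subsetI)
    fix v assume "v \<in> ?F ` ?A"
    then obtain k Q e where m: "k \<in> tops" "Q \<in> decompositions" "e \<in> same_loads f h"
      and v: "v = (fun_act \<Gamma> e (conjugator k Q), k)" by auto
    have e: "e \<in> \<Gamma> \<rightarrow>\<^sub>E carrier K" using m(3) by (simp add: same_loads_def)
    note b = class_conjugator_props[OF m(1,2)]
    note k = mem_top_class[OF m(1)]
    have "\<exists>a \<in> carrier (wreath K \<Gamma> H). conjugate (full_wreath K \<Gamma>) (f, h) a = v"
      unfolding v conjugate_in_wreath_iff[OF f h fun_act_closed[OF b(2) e] k H]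
    proof (rule bexI[OF conjI b(1)])
      show "conjugate (Sym \<Gamma>) h (conjugator k Q) = k"
        using b(3) conjugate_Sym_eq_iff[OF h b(2) k] by simp
    qed (rule decomp[OF m])
    then show "v \<in> ?B" by (auto simp: conj_class_def)
  next
    fix v assume "v \<in> ?B"
    then obtain a where a: "a \<in> carrier (wreath K \<Gamma> H)" "conjugate (full_wreath K \<Gamma>) (f, h) a = v"
      by (auto simp: conj_class_def)
    obtain e k where v: "v = (e, k)" by (cases v)
    interpret W: group "full_wreath K \<Gamma>" by (rule group_full_wreath) (rule is_group)
    have "a \<in> carrier (full_wreath K \<Gamma>)"
      using a(1) subgroup.subset[OF H] by (auto simp: wreath_def)
    then have "v \<in> carrier (full_wreath K \<Gamma>)"
      using f h unfolding a(2)[symmetric] conjugate_def by (simp add: mem_full_wreath)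
    then have e: "e \<in> \<Gamma> \<rightarrow>\<^sub>E carrier K" and k: "k permutes \<Gamma>" by (simp_all add: v mem_full_wreath)
    obtain t' where t': "t' \<in> H" "conjugate (Sym \<Gamma>) h t' = k"
        "decomp_act decomposition t' = terr_decomp K \<Gamma> (e, k)"
      using a conjugate_in_wreath_iff[OF f h e k H] unfolding v by blast
    have kc: "k \<in> tops" using t'(1,2) by (auto simp: conj_class_def)
    have inter': "t' \<circ> h = k \<circ> t'"
      using t'(2) conjugate_Sym_eq_iff[OF h H_permutes[OF t'(1)] k] by simp
    let ?t = "transversal_elt_of k"
    \<comment> \<open>\<open>t'\<close> and the element of the transversal both conjugate \<open>h\<close> to \<open>k\<close>, so they differ by an
      element of the centralizer.\<close>
    define c where "c = inv_into UNIV ?t \<circ> t'"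
    have tp: "?t permutes \<Gamma>" by (rule H_permutes[OF transversal_elt_conjugates(1)[OF kc]])
    have tc: "?t \<circ> c = t'" unfolding c_def by (simp add: comp_assoc[symmetric] permutes_inv_o[OF tp])
    have "?t \<circ> (c \<circ> h) = ?t \<circ> (h \<circ> c)"
      using tc inter' transversal_elt_conjugates(2)[OF kc] by (metis comp_assoc)
    then have "c \<circ> h = h \<circ> c"
      using permutes_inv_o(2)[OF tp] by (metis comp_assoc id_comp)
    then have cc: "c \<in> centralizer (Sym \<Gamma>) H h"
      unfolding mem_centralizer c_def using H_comp[OF t'(1) H_inv[OF transversal_elt_conjugates(1)[OF kc]]] by blast
    define Q where "Q = decomp_act decomposition c"
    have Q: "Q \<in> decompositions" using cc by (auto simp: decomp_orbit_def Q_def)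
    note b = class_conjugator_props[OF kc Q]
    have bp: "conjugator k Q permutes \<Gamma>" and inter: "conjugator k Q \<circ> h = k \<circ> conjugator k Q"
      by (rule b)+
    have "decomp_act decomposition (conjugator k Q) = decomp_act Q ?t" by (rule b(4))
    also have "\<dots> = decomp_act decomposition t'" unfolding Q_def decomp_act_comp tc ..
    also have "\<dots> = terr_decomp K \<Gamma> (e, k)" by (rule t'(3))
    finally have "\<forall>\<gamma>\<in>\<Gamma>. point_load f h \<gamma> = point_load e k (conjugator k Q \<gamma>)"
      by (rule iffD1[OF decomp_act_eq_iff[OF f h e k bp inter]])
    then have load: "point_load f h \<gamma> = point_load e k (conjugator k Q \<gamma>)" if "\<gamma> \<in> \<Gamma>" for \<gamma>
      using that by (rule bspec)
    define e' where "e' = (\<lambda>\<gamma>\<in>\<Gamma>. e (conjugator k Q \<gamma>))"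
    have e': "e' \<in> \<Gamma> \<rightarrow>\<^sub>E carrier K"
      unfolding e'_def using base_value_closed[OF e] permutes_in_image[OF bp] by auto
    have act: "fun_act \<Gamma> e' (conjugator k Q) = e"
    proof (rule extensionalityI[of _ \<Gamma>])
      fix \<epsilon> assume "\<epsilon> \<in> \<Gamma>"
      then obtain \<gamma> where "\<gamma> \<in> \<Gamma>" "\<epsilon> = conjugator k Q \<gamma>" by (rule base_point_preimage[OF bp])
      then show "fun_act \<Gamma> e' (conjugator k Q) \<epsilon> = e \<epsilon>" by (simp add: fun_act_eq[OF bp] e'_def)
    qed (use e in \<open>auto simp: fun_act_def PiE_def\<close>)
    have "e' \<in> same_loads f h"
      using e' point_load_fun_act[OF e' h bp k inter] load by (simp add: same_loads_def act)
    then have "(k, Q, e') \<in> ?A" using kc Q by simp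
    moreover have "v = ?F (k, Q, e')" by (simp add: act v)
    ultimately show "v \<in> ?F ` ?A" by (rule rev_image_eqI)
  qed
qed

end

section \<open>Products of disjoint pieces\<close>

text \<open>
  The restriction of \<open>(e, k)\<close> to a union \<open>D\<close> of orbits. An element is the product of its
  restrictions to the parts of an invariant partition, in any order; this is how the products of
  wreath cycles in the class map are evaluated.
\<close>

definition piece :: "('a \<Rightarrow> 'k) \<Rightarrow> ('a \<Rightarrow> 'a) \<Rightarrow> 'a set \<Rightarrow> ('a \<Rightarrow> 'k) \<times> ('a \<Rightarrow> 'a)" where
  "piece e k D = (restr_one K \<Gamma> D e, perm_restrict k D)"

context
  fixes e k
  assumes e: "e \<in> \<Gamma> \<rightarrow>\<^sub>E carrier K" and k: "k permutes \<Gamma>"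
begin

lemma piece_empty: "piece e k {} = \<one>\<^bsub>full_wreath K \<Gamma>\<^esub>"
  by (auto simp: piece_def wreath_def Sym_def restr_one_def perm_restrict_def)

lemma piece_whole:
  assumes "terr K \<Gamma> (e, k) \<subseteq> D"
  shows "piece e k D = (e, k)"
proof -
  have "restr_one K \<Gamma> D e = e"
    using e assms by (auto simp: restr_one_def terr_def PiE_iff extensional_def fun_eq_iff)
  moreover have "perm_restrict k D = k"
  proof (rule ext)
    fix \<gamma>
    show "perm_restrict k D \<gamma> = k \<gamma>"
      using assms by (cases "k \<gamma> = \<gamma>") (auto simp: perm_restrict_def terr_def supp_def)
  qed
  ultimately show ?thesis by (simp add: piece_def)
qed

lemma piece_mult:
  assumes "U \<subseteq> \<Gamma>" "k ` U \<subseteq> U" "U \<inter> V = {}"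
  shows "piece e k U \<otimes>\<^bsub>full_wreath K \<Gamma>\<^esub> piece e k V = piece e k (U \<union> V)"
proof -
  have "piece e k U \<otimes>\<^bsub>full_wreath K \<Gamma>\<^esub> piece e k V =
      (\<lambda>\<gamma>\<in>\<Gamma>. restr_one K \<Gamma> U e \<gamma> \<otimes> restr_one K \<Gamma> V e (perm_restrict k U \<gamma>),
        perm_restrict k V \<circ> perm_restrict k U)"
    unfolding piece_def by (rule wreath_mult[OF perm_restrict_permutes[OF finite_base k assms(1,2)]])
  also have "perm_restrict k V \<circ> perm_restrict k U = perm_restrict k (U \<union> V)"
    using assms by (auto simp: perm_restrict_def fun_eq_iff)
  also have "(\<lambda>\<gamma>\<in>\<Gamma>. restr_one K \<Gamma> U e \<gamma> \<otimes> restr_one K \<Gamma> V e (perm_restrict k U \<gamma>)) =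
      restr_one K \<Gamma> (U \<union> V) e"
  proof -
    have "restr_one K \<Gamma> U e \<gamma> \<otimes> restr_one K \<Gamma> V e (perm_restrict k U \<gamma>) =
        (if \<gamma> \<in> U \<union> V then e \<gamma> else \<one>)" if "\<gamma> \<in> \<Gamma>" for \<gamma>
    proof (cases "\<gamma> \<in> U")
      case True
      then have "k \<gamma> \<notin> V" "k \<gamma> \<in> \<Gamma>" using assms by auto
      then show ?thesis using True that base_value_closed[OF e that]
        by (simp add: restr_one_def perm_restrict_def)
    next
      case False
      then show ?thesis using that base_value_closed[OF e that]
        by (simp add: restr_one_def perm_restrict_def)
    qed
    then show ?thesis by (auto simp: restr_one_def intro!: restrict_ext)
  qed
  finally show ?thesis by (simp add: piece_def)
qed

lemma commuting_prod_pieces: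
  assumes fin: "finite A"
    and piece: "\<And>z. z \<in> A \<Longrightarrow> F z = piece e k (D z)"
    and D: "\<And>z. z \<in> A \<Longrightarrow> D z \<subseteq> \<Gamma>" "\<And>z. z \<in> A \<Longrightarrow> k ` D z \<subseteq> D z"
    and disj: "\<And>z z'. z \<in> A \<Longrightarrow> z' \<in> A \<Longrightarrow> z \<noteq> z' \<Longrightarrow> D z \<inter> D z' = {}"
  shows "commuting_prod (full_wreath K \<Gamma>) F A = piece e k (\<Union>z\<in>A. D z)"
proof (rule commuting_prod_eqI[OF fin])
  fix zs assume zs: "distinct zs" "set zs = A"
  have "ordered_prod (full_wreath K \<Gamma>) (map F zs) = piece e k (\<Union>z\<in>set zs. D z)"
    if "distinct zs" "set zs \<subseteq> A" for zs
    using that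
  proof (induction zs)
    case Nil
    show ?case by (simp add: piece_empty)
  next
    case (Cons z zs)
    have "D z \<inter> (\<Union>z\<in>set zs. D z) = {}" using Cons.prems disj[of z] by fastforce
    then have "piece e k (D z) \<otimes>\<^bsub>full_wreath K \<Gamma>\<^esub> piece e k (\<Union>z\<in>set zs. D z) =
        piece e k (D z \<union> (\<Union>z\<in>set zs. D z))"
      using Cons.prems D by (intro piece_mult) auto
    then show ?case using Cons piece by simp
  qed
  then show "ordered_prod (full_wreath K \<Gamma>) (map F zs) = piece e k (\<Union>z\<in>A. D z)"
    using zs by blast
qed

end

section \<open>The class map\<close>

context
  fixes f h pt x d b k
  assumes f: "f \<in> \<Gamma> \<rightarrow>\<^sub>E carrier K" and h: "h permutes \<Gamma>"
    and pt: "\<And>z. z \<in> wreath_cycles K \<Gamma> (f, h) \<Longrightarrow> pt z \<in> terr K \<Gamma> z"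
    and x: "x \<in> (\<Pi>\<^sub>E z\<in>wreath_cycles K \<Gamma> (f, h). conj_class K (carrier K) (Yade K \<Gamma> (pt z) z))"
    and d: "d \<in> (\<Pi>\<^sub>E z\<in>top_wreath_cycles K \<Gamma> (f, h). (supp (snd z) - {pt z}) \<rightarrow>\<^sub>E carrier K)"
    and b: "b permutes \<Gamma>" and k: "k permutes \<Gamma>" and inter: "b \<circ> h = k \<circ> b"
begin

abbreviation (input) "glued \<equiv> fun_act \<Gamma> (glue f h pt x d) b"
abbreviation (input) "cycles \<equiv> wreath_cycles K \<Gamma> (f, h)"
abbreviation (input) "top_cycles \<equiv> top_wreath_cycles K \<Gamma> (f, h)"

lemma cycle_orbit:
  assumes "z \<in> cycles"
  shows "z = orbit_cycle f h (pt z)" "terr K \<Gamma> z = orbit h (pt z)"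
  using cycle_at_pt[OF f h pt assms] terr_orbit_cycle[OF f h, of "pt z"] by simp_all

lemma snd_top_cycle:
  assumes "z \<in> top_cycles"
  shows "z \<in> cycles" "snd z = perm_restrict h (orbit h (pt z))" "supp (snd z) = orbit h (pt z)"
    "h (pt z) \<noteq> pt z"
proof -
  show z: "z \<in> cycles" using assms by (simp add: top_wreath_cycles_def)
  note c = cycle_orbit(1)[OF z]
  show "snd z = perm_restrict h (orbit h (pt z))" by (subst c) (simp add: orbit_cycle_def)
  show fixed: "h (pt z) \<noteq> pt z"
  proof
    assume "h (pt z) = pt z"
    then have "snd (orbit_cycle f h (pt z)) = id" using orbit_cycle_fixed(1)[OF f h, of "pt z"] by simp
    then have "snd z = id" by (simp only: c[symmetric])
    then show False using assms by (simp add: top_wreath_cycles_def)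
  qed
  show "supp (snd z) = orbit h (pt z)"
    by (subst c) (simp add: supp_orbit_cycle[OF f h] fixed)
qed

lemma base_cycle_fixed:
  assumes "z \<in> cycles - top_cycles"
  shows "h (pt z) = pt z" "terr K \<Gamma> z = {pt z}"
proof -
  have "snd z = id" "z \<in> cycles" using assms by (auto simp: top_wreath_cycles_def)
  then have "perm_restrict h (orbit h (pt z)) = id"
    using cycle_orbit(1)[of z] by (simp add: orbit_cycle_def) (metis snd_conv)
  then show *: "h (pt z) = pt z"
    using self_in_orbit[OF finite_base h, of "pt z"] by (metis id_apply perm_restrict_simps(1))
  then show "terr K \<Gamma> z = {pt z}"
    using cycle_orbit(2)[OF \<open>z \<in> cycles\<close>] orbit_cycle_fixed(2)[OF f h] by simp
qed

lemma base_factor: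
  assumes z: "z \<in> cycles - top_cycles"
  shows "(E_map K \<Gamma> (b (pt z)) (x z), \<one>\<^bsub>Sym \<Gamma>\<^esub>) = piece glued k (b ` terr K \<Gamma> z)"
proof -
  have zC: "z \<in> cycles" using z by simp
  note fx = base_cycle_fixed[OF z]
  have p: "pt z \<in> \<Gamma>" by (rule cycle_at_pt(2)[OF f h pt zC])
  have "glued (b (pt z)) = x z"
    using glue_at_pt[OF f h pt x d zC] orbit_cycle_fixed(2)[OF f h fx(1)]
      coord_closed[OF f h pt x d zC] by (simp add: fun_act_eq[OF b p])
  then have "E_map K \<Gamma> (b (pt z)) (x z) = restr_one K \<Gamma> {b (pt z)} glued"
    by (auto simp: E_map_def restr_one_def)
  moreover have "k (b (pt z)) = b (pt z)" using fun_cong[OF inter, of "pt z"] fx(1) by simp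
  then have "perm_restrict k {b (pt z)} = id" by (auto simp: perm_restrict_def)
  ultimately show ?thesis by (simp add: piece_def fx(2)) (simp add: Sym_def)
qed

text \<open>
  Conjugating the cycle of \<open>z\<close> by \<open>b\<close> gives the cycle of \<open>k\<close> through \<open>b \<gamma>\<^sub>z\<close>.
\<close>

lemma top_factor_perm:
  assumes z: "z \<in> top_cycles"
  shows "conjugate (Sym \<Gamma>) (snd z) b = perm_restrict k (orbit k (b (pt z)))"
proof -
  note s = snd_top_cycle[OF z]
  have p: "pt z \<in> \<Gamma>" by (rule cycle_at_pt(2)[OF f h pt s(1)])
  have bp: "b (pt z) \<in> \<Gamma>" using p permutes_in_image[OF b] by simp
  have mem: "b \<gamma> \<in> orbit k (b (pt z)) \<longleftrightarrow> \<gamma> \<in> orbit h (pt z)" for \<gamma>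
    unfolding orbit_intertwine[OF inter] using permutes_inj[OF b] by (auto dest: injD)
  show ?thesis
    unfolding s(2) conjugate_Sym_eq_iff[OF perm_restrict_orbit_permutes[OF finite_base h p] b
        perm_restrict_orbit_permutes[OF finite_base k bp]]
    using inter mem by (auto simp: fun_eq_iff perm_restrict_def)
qed

text \<open>
  The formula for \<open>B\<close> multiplies the inverses of the values of \<open>d\<close> in reverse order along the orbit,
  so its value at the distinguished point is \<open>x\<close> times the inverse of the product of the values
  of \<open>d\<close>, as in \<open>glue\<close>.
\<close>

lemma top_factor:
  assumes z: "z \<in> top_cycles"
  shows "(B_map K \<Gamma> (conjugate (Sym \<Gamma>) (snd z) b) (b (pt z)) (x z)
        (shift \<Gamma> (supp (snd z) - {pt z}) (d z) b), conjugate (Sym \<Gamma>) (snd z) b) =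
    piece glued k (b ` terr K \<Gamma> z)"
proof -
  note s = snd_top_cycle[OF z]
  have p: "pt z \<in> \<Gamma>" by (rule cycle_at_pt(2)[OF f h pt s(1)])
  have bp: "b (pt z) \<in> \<Gamma>" using p permutes_in_image[OF b] by simp
  let ?O = "orbit k (b (pt z))"
  let ?p = "perm_restrict k ?O"
  let ?n = "card (orbit h (pt z))"
  let ?D = "supp (snd z) - {pt z}"
  let ?d = "shift \<Gamma> ?D (d z) b"
  have O: "?O = b ` terr K \<Gamma> z" unfolding cycle_orbit(2)[OF s(1)] by (rule orbit_intertwine[OF inter])
  have ord: "group.ord (Sym \<Gamma>) ?p = ?n"
    using ord_orbit_cycle[OF finite_base k bp] card_orbit_intertwine[OF inter b] by simp
  have inj: "b \<gamma> = b \<delta> \<longleftrightarrow> \<gamma> = \<delta>" for \<gamma> \<delta> using permutes_inj[OF b] by (auto dest: injD)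
  have supp_p: "supp ?p = ?O"
  proof (rule supp_perm_restrict_orbit(1)[OF k finite_base])
    show "b (pt z) \<in> supp k"
      using fun_cong[OF inter, of "pt z"] s(4) inj by (auto simp: supp_def)
  qed
  have shift: "?d (b \<gamma>) = d z \<gamma>" if "\<gamma> \<in> ?D" for \<gamma>
    using that permutes_inverses(2)[OF b] by (simp add: shift_def inv_Sym[OF b])
  have pow: "(?p ^^ i) (b (pt z)) = b ((h ^^ i) (pt z))" for i
    using funpow_perm_restrict_orbit[OF self_in_orbit[OF finite_base k]] funpow_intertwine[OF inter]
    by metis
  let ?a = "\<lambda>i. d z ((h ^^ i) (pt z))"
  have "map (\<lambda>i. inv (?d ((?p ^^ (?n - i)) (b (pt z))))) [1..<?n] = map (\<lambda>i. inv (?a (?n - i))) [1..<?n]"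
  proof (intro map_cong refl)
    fix i assume "i \<in> set [1..<?n]"
    then have "(h ^^ (?n - i)) (pt z) \<in> ?D"
      by (intro orbit_past_pt(2)[OF f h pt x d s(1)]) auto
    then show "inv (?d ((?p ^^ (?n - i)) (b (pt z)))) = inv (?a (?n - i))"
      unfolding pow by (simp only: shift)
  qed
  also have "\<dots> = rev (map (\<lambda>y. inv y) (map ?a [1..<?n]))"
    using map_diff_upt_eq_rev[of "\<lambda>i. inv (?a i)" ?n] by (simp add: comp_def)
  finally have prod: "ordered_prod K (map (\<lambda>i. inv (?d ((?p ^^ (?n - i)) (b (pt z))))) [1..<?n]) =
      inv (ordered_prod K (map ?a [1..<?n]))"
    using ordered_prod_rev_inv[OF tail_list_closed[OF f h pt x d s(1)]] by simp
  have "B_map K \<Gamma> ?p (b (pt z)) (x z) ?d = restr_one K \<Gamma> ?O glued"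
  proof (rule extensionalityI[of _ \<Gamma>])
    fix \<epsilon> assume "\<epsilon> \<in> \<Gamma>"
    then obtain \<gamma> where \<gamma>: "\<gamma> \<in> \<Gamma>" "\<epsilon> = b \<gamma>" by (rule base_point_preimage[OF b])
    have b\<gamma>: "b \<gamma> \<in> \<Gamma>" using \<open>\<epsilon> \<in> \<Gamma>\<close> \<gamma>(2) by simp
    consider "\<gamma> = pt z" | "\<gamma> \<in> ?D" | "b \<gamma> \<notin> ?O" "\<gamma> \<noteq> pt z"
      unfolding orbit_intertwine[OF inter] s(3) by (auto simp: image_iff inj)
    then show "B_map K \<Gamma> ?p (b (pt z)) (x z) ?d \<epsilon> = restr_one K \<Gamma> ?O glued \<epsilon>"
    proof cases
      case 1
      have "b (pt z) \<in> ?O" by (rule self_in_orbit[OF finite_base k])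
      then have "restr_one K \<Gamma> ?O glued \<epsilon> = glue f h pt x d (pt z)"
        using bp by (simp add: restr_one_def \<gamma>(2) 1 fun_act_eq[OF b p])
      moreover have "B_map K \<Gamma> ?p (b (pt z)) (x z) ?d \<epsilon> =
          x z \<otimes> inv (ordered_prod K (map ?a [1..<?n]))"
        unfolding B_map_def ord prod using bp by (simp add: \<gamma>(2) 1)
      moreover have "glue f h pt x d (pt z) = x z \<otimes> inv (ordered_prod K (map ?a [1..<?n]))"
        by (rule glue_at_pt[OF f h pt x d s(1)])
      ultimately show ?thesis by (simp only:)
    next
      case 2
      then have "b \<gamma> \<in> ?O" "\<gamma> \<noteq> pt z" unfolding orbit_intertwine[OF inter] s(3) by auto
      then show ?thesis
        using 2 b\<gamma> glue_off_pt[OF f h pt x d z 2] shift[OF 2]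
        by (simp add: B_map_def restr_one_def \<gamma>(2) supp_p inj fun_act_eq[OF b \<gamma>(1)])
    next
      case 3
      then show ?thesis using b\<gamma> by (simp add: B_map_def restr_one_def \<gamma>(2) supp_p inj)
    qed
  qed (simp_all add: B_map_def restr_one_def)
  then show ?thesis unfolding top_factor_perm[OF z] piece_def O[symmetric] by simp
qed

text \<open>
  Each factor is the restriction of one and the same element to \<open>b ` terr z\<close>. These sets are disjoint
  and cover the territory of that element.
\<close>

lemma prod_of_factors:
  "commuting_prod (full_wreath K \<Gamma>) (\<lambda>z. (E_map K \<Gamma> (b (pt z)) (x z), \<one>\<^bsub>Sym \<Gamma>\<^esub>)) (cycles - top_cycles)
    \<otimes>\<^bsub>full_wreath K \<Gamma>\<^esub>
   commuting_prod (full_wreath K \<Gamma>)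
      (\<lambda>z. (B_map K \<Gamma> (conjugate (Sym \<Gamma>) (snd z) b) (b (pt z)) (x z)
              (shift \<Gamma> (supp (snd z) - {pt z}) (d z) b),
            conjugate (Sym \<Gamma>) (snd z) b)) top_cycles
    = (glued, k)"
proof -
  have glued: "glued \<in> \<Gamma> \<rightarrow>\<^sub>E carrier K" by (rule fun_act_closed[OF b glue_closed[OF f h pt x d]])
  let ?D = "\<lambda>z. b ` terr K \<Gamma> z"
  have fin: "finite cycles" by (rule finite_wreath_cycles[OF f h])
  have sub: "top_cycles \<subseteq> cycles" by (auto simp: top_wreath_cycles_def)
  have D: "?D z \<subseteq> \<Gamma>" "k ` ?D z \<subseteq> ?D z" if "z \<in> cycles" for z
  proof -
    have "orbit h (pt z) \<subseteq> \<Gamma>"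
      by (rule permutes_orbit_subset[OF h cycle_at_pt(2)[OF f h pt that]])
    then show "?D z \<subseteq> \<Gamma>" using cycle_orbit(2)[OF that] permutes_in_image[OF b] by auto
    show "k ` ?D z \<subseteq> ?D z"
      unfolding cycle_orbit(2)[OF that] orbit_intertwine[OF inter, symmetric]
      by (auto intro: orbit.step)
  qed
  have w: "(f, h) \<in> carrier (full_wreath K \<Gamma>)" using f h by (simp add: mem_full_wreath)
  have disj: "?D z \<inter> ?D z' = {}" if "z \<in> cycles" "z' \<in> cycles" "z \<noteq> z'" for z z'
    using wreath_cycles_disjoint[OF finite_base w that] permutes_inj[OF b]
    by (simp add: image_Int[symmetric])
  have base: "commuting_prod (full_wreath K \<Gamma>) (\<lambda>z. (E_map K \<Gamma> (b (pt z)) (x z), \<one>\<^bsub>Sym \<Gamma>\<^esub>))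
      (cycles - top_cycles) = piece glued k (\<Union>z\<in>cycles - top_cycles. ?D z)"
    using fin D disj base_factor by (intro commuting_prod_pieces[OF glued k]) auto
  have top: "commuting_prod (full_wreath K \<Gamma>)
      (\<lambda>z. (B_map K \<Gamma> (conjugate (Sym \<Gamma>) (snd z) b) (b (pt z)) (x z)
              (shift \<Gamma> (supp (snd z) - {pt z}) (d z) b),
            conjugate (Sym \<Gamma>) (snd z) b)) top_cycles = piece glued k (\<Union>z\<in>top_cycles. ?D z)"
  proof (rule commuting_prod_pieces[OF glued k finite_subset[OF sub fin] top_factor])
    fix z assume "z \<in> top_cycles"
    then show "?D z \<subseteq> \<Gamma>" "k ` ?D z \<subseteq> ?D z" using D sub by blast+
  next
    fix z z' assume "z \<in> top_cycles" "z' \<in> top_cycles" "z \<noteq> z'"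
    then show "?D z \<inter> ?D z' = {}" using disj sub by blast
  qed
  have "piece glued k (\<Union>z\<in>cycles - top_cycles. ?D z) \<otimes>\<^bsub>full_wreath K \<Gamma>\<^esub> piece glued k (\<Union>z\<in>top_cycles. ?D z) =
      piece glued k ((\<Union>z\<in>cycles - top_cycles. ?D z) \<union> (\<Union>z\<in>top_cycles. ?D z))"
  proof (rule piece_mult[OF glued k])
    show "(\<Union>z\<in>cycles - top_cycles. ?D z) \<subseteq> \<Gamma>" using D(1) by blast
    show "k ` (\<Union>z\<in>cycles - top_cycles. ?D z) \<subseteq> (\<Union>z\<in>cycles - top_cycles. ?D z)"
      unfolding image_UN by (rule UN_mono) (use D(2) in auto)
    show "(\<Union>z\<in>cycles - top_cycles. ?D z) \<inter> (\<Union>z\<in>top_cycles. ?D z) = {}" using disj sub by blast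
  qed
  also have "(\<Union>z\<in>cycles - top_cycles. ?D z) \<union> (\<Union>z\<in>top_cycles. ?D z) = (\<Union>z\<in>cycles. ?D z)" using sub by blast
  also have "piece glued k (\<Union>z\<in>cycles. ?D z) = (glued, k)"
  proof (rule piece_whole[OF glued k], rule subsetI)
    fix \<epsilon> assume \<epsilon>: "\<epsilon> \<in> terr K \<Gamma> (glued, k)"
    then have "\<epsilon> \<in> \<Gamma>" using terr_subset_base[OF glued k] by blast
    then obtain \<gamma> where \<gamma>: "\<gamma> \<in> \<Gamma>" "\<epsilon> = b \<gamma>" by (rule base_point_preimage[OF b])
    have "\<gamma> \<in> terr K \<Gamma> (f, h)"
    proof (rule ccontr)
      assume *: "\<gamma> \<notin> terr K \<Gamma> (f, h)"
      then have "h \<gamma> = \<gamma>" by (auto simp: terr_def supp_def)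
      then have "k (b \<gamma>) = b \<gamma>" using fun_cong[OF inter, of \<gamma>] by simp
      moreover have "glued (b \<gamma>) = \<one>" unfolding fun_act_eq[OF b \<gamma>(1)] using * \<gamma>(1) by (simp add: glue_def)
      ultimately show False using \<epsilon> by (simp add: \<gamma>(2) terr_def supp_def)
    qed
    then show "\<epsilon> \<in> (\<Union>z\<in>cycles. ?D z)"
      using terr_orbit_cycle[OF f h, of \<gamma>] self_in_orbit[OF finite_base h, of \<gamma>]
      unfolding wreath_cycles_eq_orbit_cycles[OF f h] \<gamma>(2) by blast
  qed
  finally show ?thesis unfolding base top .
qed

end

text \<open>
  By \<open>prod_of_factors\<close> the class map is the bijection \<open>bij_betw_glue\<close>, applied to the coordinates
  \<open>(x, d)\<close>, followed by the bijection \<open>bij_betw_relabel\<close>.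
\<close>

lemma bij_betw_class_map:
  assumes f: "f \<in> \<Gamma> \<rightarrow>\<^sub>E carrier K" and h: "h permutes \<Gamma>" and H: "subgroup H (Sym \<Gamma>)"
    and pt: "\<And>z. z \<in> wreath_cycles K \<Gamma> (f, h) \<Longrightarrow> pt z \<in> terr K \<Gamma> z"
    and T: "right_transversal ((Sym \<Gamma>)\<lparr>carrier := H\<rparr>) (centralizer (Sym \<Gamma>) H h) T"
    and rep: "\<And>Q. Q \<in> decomp_orbit K \<Gamma> H (f, h) \<Longrightarrow>
      rep Q \<in> centralizer (Sym \<Gamma>) H h \<and> decomp_act (terr_decomp K \<Gamma> (f, h)) (rep Q) = Q"
  shows "bij_betw (class_map K \<Gamma> (f, h) pt T rep) (class_param K \<Gamma> H (f, h) pt)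
    (conj_class (full_wreath K \<Gamma>) (carrier (wreath K \<Gamma> H)) (f, h))"
proof -
  let ?A = "conj_class (Sym \<Gamma>) H h" and ?O = "decomp_orbit K \<Gamma> H (f, h)"
  let ?X = "\<Pi>\<^sub>E z\<in>wreath_cycles K \<Gamma> (f, h). conj_class K (carrier K) (Yade K \<Gamma> (pt z) z)"
  let ?D = "\<Pi>\<^sub>E z\<in>top_wreath_cycles K \<Gamma> (f, h). (supp (snd z) - {pt z}) \<rightarrow>\<^sub>E carrier K"
  let ?b = "class_conjugator T h rep"
  let ?G = "\<lambda>(k, Q, e). (fun_act \<Gamma> e (?b k Q), k)"
  let ?L = "map_prod id (map_prod id (\<lambda>(x, d). glue f h pt x d))"
  have "bij_betw ?L (?A \<times> ?O \<times> ?X \<times> ?D) (?A \<times> ?O \<times> same_loads f h)"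
    by (intro bij_betw_map_prod bij_betw_id bij_betw_glue[OF f h pt])
  moreover have "bij_betw ?G (?A \<times> ?O \<times> same_loads f h)
      (conj_class (full_wreath K \<Gamma>) (carrier (wreath K \<Gamma> H)) (f, h))"
    using bij_betw_relabel[OF f h H T rep] .
  ultimately have "bij_betw (?G \<circ> ?L) (?A \<times> ?O \<times> ?X \<times> ?D)
      (conj_class (full_wreath K \<Gamma>) (carrier (wreath K \<Gamma> H)) (f, h))"
    by (rule bij_betw_trans)
  moreover have eq: "class_map K \<Gamma> (f, h) pt T rep p = (?G \<circ> ?L) p" if "p \<in> ?A \<times> ?O \<times> ?X \<times> ?D" for p
  proof -
    obtain k Q x d where p: "p = (k, Q, x, d)" by (cases p)
    have m: "k \<in> ?A" "Q \<in> ?O" "x \<in> ?X" "d \<in> ?D" using that by (auto simp: p)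
    note tc = class_conjugator_props[OF f h H T rep m(1,2)]
    show ?thesis
      using prod_of_factors[OF f h pt m(3,4) tc(2) mem_top_class[OF f h H T rep m(1)] tc(3)]
      by (simp add: class_map_def p Let_def class_conjugator_def transversal_elt_def)
  qed
  moreover have "bij_betw (class_map K \<Gamma> (f, h) pt T rep) (?A \<times> ?O \<times> ?X \<times> ?D) V =
      bij_betw (?G \<circ> ?L) (?A \<times> ?O \<times> ?X \<times> ?D) V" for V
    by (rule bij_betw_cong) (rule eq)
  ultimately show ?thesis unfolding class_param_def snd_conv by blast
qed

end

theorem theorem1:
  fixes K :: "('k, 'b) monoid_scheme"
    and \<Gamma> :: "'a set"
    and H :: "('a \<Rightarrow> 'a) set"
  assumes "group K" and "finite \<Gamma>" and "subgroup H (Sym \<Gamma>)"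
  shows
    "(\<forall>w \<in> carrier (full_wreath K \<Gamma>). \<forall>v \<in> carrier (full_wreath K \<Gamma>).
        (\<exists>a \<in> carrier (wreath K \<Gamma> H). conjugate (full_wreath K \<Gamma>) w a = v) \<longleftrightarrow>
        (\<exists>t \<in> H. conjugate (Sym \<Gamma>) (snd w) t = snd v \<and>
           decomp_act (terr_decomp K \<Gamma> w) t = terr_decomp K \<Gamma> v))
     \<and>
     (\<forall>w \<in> carrier (full_wreath K \<Gamma>). \<forall>pt T rep.
        (\<forall>z \<in> wreath_cycles K \<Gamma> w. pt z \<in> terr K \<Gamma> z) \<longrightarrow>
        right_transversal ((Sym \<Gamma>)\<lparr>carrier := H\<rparr>) (centralizer (Sym \<Gamma>) H (snd w)) T \<longrightarrow>
        (\<forall>Q \<in> decomp_orbit K \<Gamma> H w. rep Q \<in> centralizer (Sym \<Gamma>) H (snd w) \<and>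
           decomp_act (terr_decomp K \<Gamma> w) (rep Q) = Q) \<longrightarrow>
        bij_betw (class_map K \<Gamma> w pt T rep)
          (class_param K \<Gamma> H w pt)
          (conj_class (full_wreath K \<Gamma>) (carrier (wreath K \<Gamma> H)) w))"
proof -
  interpret wreath_base K \<Gamma>
    using assms(1,2) by (simp add: wreath_base_def wreath_base_axioms_def)
  show ?thesis
  proof (intro conjI ballI allI impI)
    fix w v assume wv: "w \<in> carrier (full_wreath K \<Gamma>)" "v \<in> carrier (full_wreath K \<Gamma>)"
    obtain f h e g where w: "w = (f, h)" and v: "v = (e, g)" by (metis surj_pair)
    show "(\<exists>a \<in> carrier (wreath K \<Gamma> H). conjugate (full_wreath K \<Gamma>) w a = v) \<longleftrightarrow>
        (\<exists>t \<in> H. conjugate (Sym \<Gamma>) (snd w) t = snd v \<and>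
           decomp_act (terr_decomp K \<Gamma> w) t = terr_decomp K \<Gamma> v)"
      unfolding w v snd_conv
      by (rule conjugate_in_wreath_iff) (use wv assms in \<open>simp_all add: w v mem_full_wreath\<close>)
  next
    fix w pt T rep
    assume a: "w \<in> carrier (full_wreath K \<Gamma>)" "\<forall>z \<in> wreath_cycles K \<Gamma> w. pt z \<in> terr K \<Gamma> z"
      "right_transversal ((Sym \<Gamma>)\<lparr>carrier := H\<rparr>) (centralizer (Sym \<Gamma>) H (snd w)) T"
      "\<forall>Q \<in> decomp_orbit K \<Gamma> H w. rep Q \<in> centralizer (Sym \<Gamma>) H (snd w) \<and>
           decomp_act (terr_decomp K \<Gamma> w) (rep Q) = Q"
    obtain f h where w: "w = (f, h)" by (cases w)
    show "bij_betw (class_map K \<Gamma> w pt T rep) (class_param K \<Gamma> H w pt)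
          (conj_class (full_wreath K \<Gamma>) (carrier (wreath K \<Gamma> H)) w)"
      unfolding w
    proof (rule bij_betw_class_map)
      show "f \<in> \<Gamma> \<rightarrow>\<^sub>E carrier K" "h permutes \<Gamma>" using a(1) by (simp_all add: w mem_full_wreath)
      show "subgroup H (Sym \<Gamma>)" by (rule assms(3))
      show "pt z \<in> terr K \<Gamma> z" if "z \<in> wreath_cycles K \<Gamma> (f, h)" for z
        using a(2) that unfolding w by (rule bspec)
      show "right_transversal ((Sym \<Gamma>)\<lparr>carrier := H\<rparr>) (centralizer (Sym \<Gamma>) H h) T"
        using a(3) unfolding w snd_conv .
      show "rep Q \<in> centralizer (Sym \<Gamma>) H h \<and> decomp_act (terr_decomp K \<Gamma> (f, h)) (rep Q) = Q"
        if "Q \<in> decomp_orbit K \<Gamma> H (f, h)" for Q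
        using a(4) that unfolding w snd_conv by (rule bspec)
    qed
  qed
qed

end
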